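(* Let $G=(V,E)$ be an infinite connected graph with maximal degree at most $K\in\mathbb N$. Let $(V_m)_{m\ge1}$ be an increasing sequence of finite subsets of $V$ with $\bigcup_m V_m=V$ such that the induced subgraphs $G_m$ are connected, and let $v_0\in V_1$. Let $\beta>0$, $u\in[0,1]$, $\theta=1$, and let $\mathbb P_m$ be the random loop measure on $G_m$ with parameters $(\beta,u,1)$. Let $p_c(G)$ be the critical parameter of Bernoulli bond percolation on $G$, and put \[ \delta(\beta,u,1)=\frac{1}{2}\left(\frac{u}{K}\right)^2\frac{\beta}{\beta+3\cdot 4^{K+1}}\left(\frac{\beta}{e^{\beta}-1}\right)^{2K-1}. \] If $(1-e^{-\beta})(1-\delta(\beta,u,1))<p_c(G)$, then loop percolation does not occur, i.e. \[ \liminf_{R\to\infty}\liminf_{m\to\infty}\mathbb P_m\big(v_0\Longleftrightarrow w\text{ for some } w\in V_m \text{ with } d(v_0,w)\ge R\big)=0, \] where $d$ denotes the graph distance.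
   Context: A link configuration on a finite graph $(V',E')$ is a finite sequence $c=(e_i,s_i)_{i\le n}$ with $n\in\mathbb N_0$, $e_i\in E'$ and $s_i\in\{-1,1\}$, where $s_i=1$ is a "cross" and $s_i=-1$ is a "double bar". Random loop measure with parameters $(\beta,u,1)$: draw independent $\mathrm{Poisson}(\beta)$ numbers of links for each edge. Order the resulting multiset of edges by a uniformly random permutation, and give each link independently type $1$ with probability $u$ and type $-1$ otherwise. Loops: place the $i$-th link at time $i/(n+1)$ on the edge $e_i$, and view time $[0,1)$ as a circle. A trajectory moving in time along a vertex jumps to the other endpoint of $e_i$ when it meets time $i/(n+1)$ at an endpoint of $e_i$. After a cross it continues in the same time direction, and after a double bar it reverses direction. The closed trajectories are the loops. For $v,w\in V'$, write $v\Longleftrightarrow w$ if the loop passing through $(v,0)$ also passes through $(w,0)$. *)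

theory Defs
  imports "HOL-Probability.Probability" "HOL-Combinatorics.Multiset_Permutations"
begin

text \<open>Graphs: vertex type 'v, symmetric irreflexive adjacency relation E.
  Edges are represented as two-element sets {x,y}.\<close>

definition gedges :: "('v \<Rightarrow> 'v \<Rightarrow> bool) \<Rightarrow> 'v set set" where
  "gedges E = {{x, y} | x y. E x y}"

definition induced :: "('v \<Rightarrow> 'v \<Rightarrow> bool) \<Rightarrow> 'v set \<Rightarrow> 'v \<Rightarrow> 'v \<Rightarrow> bool" where
  "induced E W = (\<lambda>x y. E x y \<and> x \<in> W \<and> y \<in> W)"

definition gdist :: "('v \<Rightarrow> 'v \<Rightarrow> bool) \<Rightarrow> 'v \<Rightarrow> 'v \<Rightarrow> nat" where
  "gdist E v w = (LEAST n. \<exists>p. p 0 = v \<and> p n = w \<and> (\<forall>i<n. E (p i) (p (Suc i))))"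

text \<open>Random loop measure with parameters (beta,u,1) on a finite edge set Es.
  A link configuration is a list of (edge, type) with type 1 = cross, -1 = double bar.\<close>
definition loop_measure :: "real \<Rightarrow> real \<Rightarrow> 'e set \<Rightarrow> ('e \<times> int) list pmf" where
  "loop_measure \<beta> u Es = do {
     N \<leftarrow> Pi_pmf Es 0 (\<lambda>_. poisson_pmf \<beta>);
     es \<leftarrow> pmf_of_set (permutations_of_multiset (\<Sum>e\<in>Es. replicate_mset (N e) e));
     s \<leftarrow> Pi_pmf {..<length es} False (\<lambda>_. bernoulli_pmf u);
     return_pmf (map (\<lambda>i. (es ! i, if s i then 1 else -1)) [0..<length es])
   }"

definition other_end :: "'v set \<Rightarrow> 'v \<Rightarrow> 'v" where
  "other_end e x = (THE y. y \<in> e \<and> y \<noteq> x)"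

text \<open>Loop dynamics. With n = length c, the i-th link (i = 1..n, i.e. c!(i-1)) sits at
  time i/(n+1). A state (x, j, up) means: at vertex x, in the time interval
  (j/(n+1), (j+1)/(n+1)) (j = 0..n, slot n wraps around through time 0 to slot 0),
  moving upward in time if up = True, downward otherwise.\<close>
definition loop_step :: "('v set \<times> int) list \<Rightarrow> 'v \<times> nat \<times> bool \<Rightarrow> 'v \<times> nat \<times> bool" where
  "loop_step c st = (case st of (x, j, up) \<Rightarrow>
     (let n = length c in
      if up then
        (if j = n then (x, 0, True)
         else (case c ! j of (e, s) \<Rightarrow>
           if x \<in> e then (if s = 1 then (other_end e x, j + 1, True) else (other_end e x, j, False))
           else (x, j + 1, True)))
      else
        (if j = 0 then (x, n, False)
         else (case c ! (j - 1) of (e, s) \<Rightarrow>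
           if x \<in> e then (if s = 1 then (other_end e x, j - 1, False) else (other_end e x, j, True))
           else (x, j - 1, False)))))"

definition loop_conn :: "('v set \<times> int) list \<Rightarrow> 'v \<Rightarrow> 'v \<Rightarrow> bool" where
  "loop_conn c v w = (\<exists>k d. (loop_step c ^^ k) (v, 0, True) = (w, 0, d))"

definition perc_measure :: "('v \<Rightarrow> 'v \<Rightarrow> bool) \<Rightarrow> real \<Rightarrow> ('v set \<Rightarrow> bool) measure" where
  "perc_measure E p = (\<Pi>\<^sub>M e\<in>gedges E. measure_pmf (bernoulli_pmf p))"

definition open_cluster :: "('v \<Rightarrow> 'v \<Rightarrow> bool) \<Rightarrow> ('v set \<Rightarrow> bool) \<Rightarrow> 'v \<Rightarrow> 'v set" where
  "open_cluster E \<omega> v = {w. (\<lambda>x y. E x y \<and> \<omega> {x, y})\<^sup>*\<^sup>* v w}"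

definition perc_theta :: "('v \<Rightarrow> 'v \<Rightarrow> bool) \<Rightarrow> 'v \<Rightarrow> real \<Rightarrow> real" where
  "perc_theta E v p = measure (perc_measure E p)
     {\<omega> \<in> space (perc_measure E p). infinite (open_cluster E \<omega> v)}"

definition p_crit :: "('v \<Rightarrow> 'v \<Rightarrow> bool) \<Rightarrow> 'v \<Rightarrow> real" where
  "p_crit E v = Sup {p \<in> {0..1}. perc_theta E v p = 0}"

definition delta_loop :: "real \<Rightarrow> real \<Rightarrow> nat \<Rightarrow> real" where
  "delta_loop \<beta> u K = 1/2 * (u / real K)^2 * (\<beta> / (\<beta> + 3 * 4^(K+1)))
                       * (\<beta> / (exp \<beta> - 1))^(2*K - 1)"

end

theory Submission
  imports Defs
begin

text \<open>Call an edge \<open>e\<close> cancelled if it carries exactly two links, both of them crosses, and no link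
  touching \<open>e\<close> lies between them. A loop that crosses a cancelled edge is taken back by the second
  cross, so the loop of \<open>v\<close> stays in the cluster of \<open>v\<close> formed by the edges that carry a link and
  are not cancelled. It remains to dominate these edges by Bernoulli percolation with a parameter
  \<open>p < p\<^sub>c\<close>.

  Fix a set \<open>C\<close> of edges whose neighbourhoods (the edges touching them) are pairwise disjoint.
  Links on disjoint edge sets are independent. Given which edges carry links, the edges of
  \<open>C\<close> among them are hence cancelled independently, each with probability at least
  \<open>x = \<beta> u\<^sup>2 r ^ (2K - 1) / (2K)\<close> where \<open>r = \<beta> / (exp \<beta> - 1)\<close> is the probability of a single link
  given at least one. So the usable edges are dominated by a product measure with parameter
  \<open>1 - exp (-\<beta>)\<close>, lowered by the factor \<open>1 - x\<close> on \<open>C\<close>. Finally \<open>C\<close> is averaged with respect to a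
  hard-core measure: given the states of all other edges, every edge belongs to \<open>C\<close> with probability
  of order \<open>1 / K\<^sup>2\<close>, so the mixture is dominated by a homogeneous Bernoulli measure with parameter
  at most \<open>(1 - exp (-\<beta>)) (1 - \<delta>)\<close>.\<close>

section \<open>Bernoulli weights and domination\<close>

text \<open>The probability that the random subset of \<open>S\<close> containing each
  \<open>e\<close> independently with probability \<open>p e\<close> equals \<open>Z\<close>, for
  \<open>Z\<close> inside \<open>S\<close>. Domination then becomes algebra with finite
  sums.\<close>

definition bern_weight :: "('e \<Rightarrow> real) \<Rightarrow> 'e set \<Rightarrow> 'e set \<Rightarrow> real" where
  "bern_weight p S Z = (\<Prod>e\<in>Z. p e) * (\<Prod>e\<in>S - Z. 1 - p e)"

definition bern_exp :: "('e \<Rightarrow> real) \<Rightarrow> 'e set \<Rightarrow> ('e set \<Rightarrow> real) \<Rightarrow> real" where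
  "bern_exp p S f = (\<Sum>Z\<in>Pow S. bern_weight p S Z * f Z)"

lemma sum_Pow_insert:
  fixes g :: "'e set \<Rightarrow> 'a::comm_monoid_add"
  assumes "finite S" "e \<notin> S"
  shows "(\<Sum>Z\<in>Pow (insert e S). g Z) = (\<Sum>Z\<in>Pow S. g Z + g (insert e Z))"
proof -
  have "(\<Sum>Z\<in>insert e ` Pow S. g Z) = (\<Sum>Z\<in>Pow S. g (insert e Z))"
    by (rule sum.reindex_cong[where l = "insert e"]) (use assms in \<open>auto simp: inj_on_def\<close>)
  moreover have "Pow S \<inter> insert e ` Pow S = {}"
    using assms by auto
  ultimately show ?thesis
    using assms by (simp add: Pow_insert sum.union_disjoint sum.distrib)
qed

lemma bern_weight_insert_out:
  assumes "finite S" "e \<notin> S" "Z \<subseteq> S"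
  shows "bern_weight p (insert e S) Z = (1 - p e) * bern_weight p S Z"
proof -
  have "insert e S - Z = insert e (S - Z)" using assms by auto
  then show ?thesis using assms by (simp add: bern_weight_def)
qed

lemma bern_weight_insert_in:
  assumes "finite S" "e \<notin> S" "Z \<subseteq> S"
  shows "bern_weight p (insert e S) (insert e Z) = p e * bern_weight p S Z"
proof -
  have "insert e S - insert e Z = S - Z" "finite Z" "e \<notin> Z"
    using assms finite_subset by auto
  then show ?thesis using assms by (simp add: bern_weight_def)
qed

lemma bern_weight_nonneg:
  assumes "Z \<subseteq> S" "\<And>e. e \<in> S \<Longrightarrow> 0 \<le> p e \<and> p e \<le> 1"
  shows "0 \<le> bern_weight p S Z"
  unfolding bern_weight_def using assms by (intro mult_nonneg_nonneg prod_nonneg) auto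

lemma bern_exp_empty [simp]: "bern_exp p {} f = f {}"
  by (simp add: bern_exp_def bern_weight_def)

text \<open>Conditioning on whether \<open>e\<close> is present; this recursion drives the
  inductions over \<open>S\<close> below.\<close>

lemma bern_exp_insert:
  assumes "finite S" "e \<notin> S"
  shows "bern_exp p (insert e S) f
           = (1 - p e) * bern_exp p S f + p e * bern_exp p S (\<lambda>Z. f (insert e Z))"
proof -
  have "bern_exp p (insert e S) f
      = (\<Sum>Z\<in>Pow S. (1 - p e) * (bern_weight p S Z * f Z) + p e * (bern_weight p S Z * f (insert e Z)))"
    unfolding bern_exp_def sum_Pow_insert[OF assms]
    by (intro sum.cong refl) (simp add: bern_weight_insert_in bern_weight_insert_out assms)
  then show ?thesis
    by (simp add: bern_exp_def sum.distrib sum_distrib_left)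
qed

lemma bern_exp_linear:
  "bern_exp p S (\<lambda>Z. a * f Z + b * g Z) = a * bern_exp p S f + b * bern_exp p S g"
  by (simp add: bern_exp_def sum_distrib_left sum.distrib algebra_simps)

lemma bern_exp_cong:
  "(\<And>Z. Z \<subseteq> S \<Longrightarrow> f Z = g Z) \<Longrightarrow> bern_exp p S f = bern_exp p S g"
  by (auto simp: bern_exp_def intro!: sum.cong)

text \<open>The intersection of two independent product sets contains \<open>e\<close> iff both do,
  hence with probability \<open>q e * t e\<close>. Used for the edges that carry links and an
  independent thinning of them.\<close>

lemma bern_exp_inter:
  assumes "finite S"
  shows "bern_exp q S (\<lambda>O'. bern_exp t S (\<lambda>T. f (O' \<inter> T))) = bern_exp (\<lambda>e. q e * t e) S f"
  using assms
proof (induction S arbitrary: f rule: finite_induct)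
  case (insert e S)
  have 1: "bern_exp q S (\<lambda>Z. bern_exp t S (\<lambda>Za. f (Z \<inter> insert e Za)))
      = bern_exp q S (\<lambda>Z. bern_exp t S (\<lambda>Za. f (Z \<inter> Za)))" for f
    using insert.hyps by (intro bern_exp_cong) (auto intro!: arg_cong[of _ _ f])
  have 2: "bern_exp q S (\<lambda>Z. bern_exp t S (\<lambda>Za. f (insert e Z \<inter> Za)))
      = bern_exp q S (\<lambda>Z. bern_exp t S (\<lambda>Za. f (Z \<inter> Za)))" for f
    using insert.hyps by (intro bern_exp_cong) (auto intro!: arg_cong[of _ _ f])
  have 3: "bern_exp q S (\<lambda>Z. bern_exp t S (\<lambda>Za. f (insert e Z \<inter> insert e Za)))
      = bern_exp q S (\<lambda>Z. bern_exp t S (\<lambda>Za. f (insert e (Z \<inter> Za))))" for f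
    by (intro bern_exp_cong) (auto intro!: arg_cong[of _ _ f])
  show ?case
    unfolding bern_exp_insert[OF insert.hyps] bern_exp_linear 1 2 3 insert.IH[of f]
      insert.IH[of "\<lambda>Z. f (insert e Z)"]
    by (simp add: algebra_simps)
qed simp

lemma bern_exp_const [simp]: "finite S \<Longrightarrow> bern_exp p S (\<lambda>_. c) = c"
  by (induction S rule: finite_induct) (auto simp: bern_exp_insert algebra_simps)

text \<open>The hypothesis says that, given the states of all other elements, \<open>e\<close> is present with
  conditional probability at most \<open>p e\<close>; dividing by the possibly vanishing probability of the
  condition is avoided.\<close>
lemma bern_domination:
  assumes "finite S"
    and "\<And>e Z. e \<in> S \<Longrightarrow> Z \<subseteq> S - {e} \<Longrightarrow> a (insert e Z) \<le> p e * (a Z + a (insert e Z))"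
    and "\<And>e. e \<in> S \<Longrightarrow> 0 \<le> p e \<and> p e \<le> 1" and "mono f"
  shows "(\<Sum>Z\<in>Pow S. a Z * f Z) \<le> (\<Sum>Z\<in>Pow S. a Z) * bern_exp p S f"
  using assms
proof (induction S arbitrary: a f rule: finite_induct)
  case empty
  then show ?case by simp
next
  case (insert e S)
  \<comment> \<open>Summing out \<open>e\<close>: the hypothesis on \<open>a\<close> is linear, so
    its instances at \<open>Z\<close> and \<open>insert e Z\<close> add up to the one for
    \<open>a'\<close>.\<close>
  define a' where "a' = (\<lambda>Z. a Z + a (insert e Z))"
  have a': "a' (insert g Z) \<le> p g * (a' Z + a' (insert g Z))" if "g \<in> S" "Z \<subseteq> S - {g}" for g Z
  proof -
    have "e \<noteq> g" using that insert.hyps by auto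
    then have "a (insert g Z) \<le> p g * (a Z + a (insert g Z))"
      "a (insert g (insert e Z)) \<le> p g * (a (insert e Z) + a (insert g (insert e Z)))"
      using that insert.prems(1)[of g Z] insert.prems(1)[of g "insert e Z"] by auto
    then show ?thesis
      unfolding a'_def by (simp add: insert_commute algebra_simps)
  qed
  have mono': "mono (\<lambda>Z. f (insert e Z))"
    using insert.prems(3) by (auto intro!: monoI elim!: monoD)
  have "(\<Sum>Z\<in>Pow (insert e S). a Z * f Z)
      = (\<Sum>Z\<in>Pow S. a Z * f Z + a (insert e Z) * f (insert e Z))"
    by (simp add: sum_Pow_insert insert.hyps)
  also have "\<dots> \<le> (\<Sum>Z\<in>Pow S. (1 - p e) * (a' Z * f Z) + p e * (a' Z * f (insert e Z)))"
  proof (rule sum_mono)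
    fix Z assume "Z \<in> Pow S"
    then have "a (insert e Z) \<le> p e * a' Z"
      using insert.prems(1)[of e Z] insert.hyps by (auto simp: a'_def)
    moreover have "f Z \<le> f (insert e Z)"
      using insert.prems(3) by (auto intro: monoD)
    \<comment> \<open>This product is exactly the difference of the two sides to be
      compared.\<close>
    ultimately have "0 \<le> (p e * a' Z - a (insert e Z)) * (f (insert e Z) - f Z)"
      by simp
    then show "a Z * f Z + a (insert e Z) * f (insert e Z)
        \<le> (1 - p e) * (a' Z * f Z) + p e * (a' Z * f (insert e Z))"
      by (simp add: a'_def algebra_simps)
  qed
  also have "\<dots> = (1 - p e) * (\<Sum>Z\<in>Pow S. a' Z * f Z) + p e * (\<Sum>Z\<in>Pow S. a' Z * f (insert e Z))"
    by (simp add: sum.distrib sum_distrib_left)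
  also have "\<dots> \<le> (1 - p e) * ((\<Sum>Z\<in>Pow S. a' Z) * bern_exp p S f)
      + p e * ((\<Sum>Z\<in>Pow S. a' Z) * bern_exp p S (\<lambda>Z. f (insert e Z)))"
    using insert.IH[OF a' _ insert.prems(3)] insert.IH[OF a' _ mono'] insert.prems(2)
    by (intro add_mono mult_left_mono) auto
  also have "\<dots> = (\<Sum>Z\<in>Pow (insert e S). a Z) * bern_exp p (insert e S) f"
    unfolding bern_exp_insert[OF insert.hyps] sum_Pow_insert[OF insert.hyps] a'_def
    by (simp only: ring_distribs mult_ac)
  finally show ?case .
qed

section \<open>Cancelled edges\<close>

text \<open>Filtering first means that the two crosses need only be adjacent among the links
  touching \<open>e\<close>, and that these links alone determine the property.\<close>

definition cancelled :: "('v set \<times> int) list \<Rightarrow> 'v set \<Rightarrow> bool" where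
  "cancelled c e \<longleftrightarrow> (\<exists>xs ys. filter (\<lambda>l. fst l \<inter> e \<noteq> {}) c = xs @ (e, 1) # (e, 1) # ys \<and>
     e \<notin> fst ` (set xs \<union> set ys))"

lemma filter_eq_appendE:
  assumes "filter P c = xs @ ys"
  obtains us vs where "c = us @ vs" "filter P us = xs" "filter P vs = ys"
proof -
  have "\<exists>us vs. c = us @ vs \<and> filter P us = xs \<and> filter P vs = ys"
    using assms
  proof (induction xs arbitrary: c)
    case Nil
    then show ?case by (intro exI[of _ "[]"] exI[of _ c]) auto
  next
    case (Cons x xs)
    then obtain us c' where 1: "c = us @ x # c'" "\<forall>u\<in>set us. \<not> P u" "P x" "filter P c' = xs @ ys"
      by (auto simp: filter_eq_Cons_iff)
    then obtain us' vs where "c' = us' @ vs" "filter P us' = xs" "filter P vs = ys"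
      using Cons.IH by blast
    then show ?case using 1 by (intro exI[of _ "us @ x # us'"] exI[of _ vs]) auto
  qed
  then show thesis by (elim exE conjE) (rule that)
qed

text \<open>\<open>W\<close> is the set of time slots between the two crosses.\<close>
lemma cancelled_window:
  assumes "cancelled c e" "e \<noteq> {}"
  obtains W where "0 \<notin> W" "length c \<notin> W"
    "\<And>i. i < length c \<Longrightarrow> fst (c ! i) = e \<Longrightarrow> snd (c ! i) = 1 \<and> (i \<in> W \<longleftrightarrow> Suc i \<notin> W)"
    "\<And>i. i < length c \<Longrightarrow> fst (c ! i) \<inter> e \<noteq> {} \<Longrightarrow> fst (c ! i) \<noteq> e \<Longrightarrow> i \<notin> W \<and> Suc i \<notin> W"
    "\<And>i. i < length c \<Longrightarrow> fst (c ! i) \<inter> e = {} \<Longrightarrow> i \<in> W \<longleftrightarrow> Suc i \<in> W"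
proof -
  obtain xs ys where f: "filter (\<lambda>l. fst l \<inter> e \<noteq> {}) c = xs @ (e, 1) # (e, 1) # ys"
    and e: "e \<notin> fst ` (set xs \<union> set ys)"
    using assms by (auto simp: cancelled_def)
  obtain us c' where 1: "c = us @ c'" "filter (\<lambda>l. fst l \<inter> e \<noteq> {}) us = xs"
    "filter (\<lambda>l. fst l \<inter> e \<noteq> {}) c' = (e, 1) # (e, 1) # ys"
    using f by (elim filter_eq_appendE)
  obtain us' c'' where 2: "c' = us' @ (e, 1) # c''" "\<forall>l\<in>set us'. \<not> fst l \<inter> e \<noteq> {}"
    "(e, 1) # ys = filter (\<lambda>l. fst l \<inter> e \<noteq> {}) c''"
    using filter_eq_ConsD[OF 1(3)] by blast
  obtain vs ws where 3: "c'' = vs @ (e, 1) # ws" "\<forall>l\<in>set vs. \<not> fst l \<inter> e \<noteq> {}"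
    "ys = filter (\<lambda>l. fst l \<inter> e \<noteq> {}) ws"
    using filter_eq_ConsD[OF 2(3)[symmetric]] by blast
  have us: "fst l \<noteq> e" if "l \<in> set (us @ us')" for l
  proof
    assume "fst l = e"
    moreover then have "l \<in> set us"
      using that 2(2) assms(2) by auto
    ultimately have "l \<in> set xs" using 1(2) assms(2) by auto
    then show False using e \<open>fst l = e\<close> by (auto simp: image_iff)
  qed
  have ws: "fst l \<noteq> e" if "l \<in> set ws" for l
  proof
    assume "fst l = e"
    then have "l \<in> set ys" using that 3(3) assms(2) by auto
    then show False using e \<open>fst l = e\<close> by (auto simp: image_iff)
  qed
  \<comment> \<open>\<open>c ! a\<close> and \<open>c ! b\<close> are the two crosses. Slot
    \<open>j\<close> lies just before link \<open>c ! j\<close>, so the slots between them run from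
    \<open>Suc a\<close> to \<open>b\<close>.\<close>
  define a where "a = length (us @ us')"
  define b where "b = Suc (a + length vs)"
  define W where "W = {Suc a..b}"
  have c: "c = (us @ us') @ (e, 1) # vs @ (e, 1) # ws"
    using 1 2 3 by simp
  have len: "length c = Suc (b + length ws)"
    unfolding c b_def a_def by simp
  have cases: "(i < a \<and> fst (c ! i) \<noteq> e) \<or> (i = a \<and> fst (c ! i) = e \<and> snd (c ! i) = 1) \<or>
      (a < i \<and> i < b \<and> fst (c ! i) \<inter> e = {}) \<or> (i = b \<and> fst (c ! i) = e \<and> snd (c ! i) = 1) \<or>
      (b < i \<and> fst (c ! i) \<noteq> e)" if "i < length c" for i
  proof -
    consider "i < a" | "i = a" | "a < i" "i < b" | "i = b" | "b < i" by linarith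
    then show ?thesis
    proof cases
      case 1
      then have "c ! i = (us @ us') ! i" unfolding c a_def by (simp only: nth_append if_True)
      with 1 us show ?thesis using nth_mem[of i "us @ us'"] unfolding a_def by metis
    next
      case 2
      then show ?thesis unfolding c a_def by (simp add: nth_append)
    next
      case 3
      then have "c ! i = vs ! (i - Suc a)"
        unfolding c b_def a_def by (auto simp: nth_append nth_Cons' simp del: append_assoc)
      moreover have "i - Suc a < length vs" using 3 b_def by auto
      ultimately have "fst (c ! i) \<inter> e = {}" using \<open>\<forall>l\<in>set vs. \<not> fst l \<inter> e \<noteq> {}\<close> nth_mem by metis
      then show ?thesis using 3 by simp
    next
      case 4
      then have "c ! i = (e, 1)"
        unfolding c b_def a_def by (auto simp: nth_append nth_Cons' simp del: append_assoc)
      then show ?thesis using 4 by simp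
    next
      case 5
      then have "c ! i = ws ! (i - Suc b)"
        unfolding c b_def a_def by (auto simp: nth_append nth_Cons' simp del: append_assoc)
      moreover have "i - Suc b < length ws" using 5 that len by auto
      ultimately have "fst (c ! i) \<noteq> e" using ws nth_mem by metis
      then show ?thesis using 5 by simp
    qed
  qed
  have "a < b" by (simp add: b_def)
  show ?thesis
  proof (rule that[of W])
    fix i assume i: "i < length c"
    show "snd (c ! i) = 1 \<and> (i \<in> W \<longleftrightarrow> Suc i \<notin> W)" if "fst (c ! i) = e"
      using cases[OF i] that assms(2) \<open>a < b\<close> by (auto simp: W_def)
    show "i \<notin> W \<and> Suc i \<notin> W" if "fst (c ! i) \<inter> e \<noteq> {}" "fst (c ! i) \<noteq> e"
      using cases[OF i] that by (auto simp: W_def)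
    show "i \<in> W \<longleftrightarrow> Suc i \<in> W" if "fst (c ! i) \<inter> e = {}"
      using cases[OF i] that assms(2) by (auto simp: W_def)
  qed (use len in \<open>auto simp: W_def\<close>)
qed

lemma other_end_doubleton:
  assumes "x \<noteq> y"
  shows "other_end {x, y} x = y" "other_end {x, y} y = x"
  using assms by (auto simp: other_end_def intro!: the_equality)

text \<open>Two crosses that are consecutive among the links touching \<open>e\<close> cancel: a trajectory that
  uses one of them stays at the other endpoint of \<open>e\<close> until it is taken back by the other one.
  Outside of these excursions it therefore never crosses \<open>e\<close>.\<close>
lemma loop_conn_imp_cluster:
  assumes edges: "\<And>l. l \<in> set c \<Longrightarrow> \<exists>x y. x \<noteq> y \<and> fst l = {x, y}"
    and disj: "\<And>e f. e \<in> B \<Longrightarrow> f \<in> B \<Longrightarrow> e \<noteq> f \<Longrightarrow> e \<inter> f = {}"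
    and canc: "\<And>e. e \<in> B \<Longrightarrow> cancelled c e \<and> e \<noteq> {}"
    and "loop_conn c v w"
  shows "(\<lambda>x y. {x, y} \<in> fst ` set c - B)\<^sup>*\<^sup>* v w"
proof -
  \<comment> \<open>\<open>P e W\<close> collects the properties of a window, so that one window per
    edge of \<open>B\<close> can be chosen.\<close>
  define P where "P = (\<lambda>e W. 0 \<notin> W \<and> length c \<notin> W \<and> (\<forall>i<length c.
      (fst (c ! i) = e \<longrightarrow> snd (c ! i) = 1 \<and> (i \<in> W \<longleftrightarrow> Suc i \<notin> W)) \<and>
      (fst (c ! i) \<inter> e \<noteq> {} \<longrightarrow> fst (c ! i) \<noteq> e \<longrightarrow> i \<notin> W \<and> Suc i \<notin> W) \<and>
      (fst (c ! i) \<inter> e = {} \<longrightarrow> (i \<in> W \<longleftrightarrow> Suc i \<in> W))))"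
  have "\<forall>e\<in>B. \<exists>W. P e W"
  proof
    fix e assume "e \<in> B"
    note e = canc[OF this]
    obtain W where "0 \<notin> W" "length c \<notin> W"
      "\<And>i. i < length c \<Longrightarrow> fst (c ! i) = e \<Longrightarrow> snd (c ! i) = 1 \<and> (i \<in> W \<longleftrightarrow> Suc i \<notin> W)"
      "\<And>i. i < length c \<Longrightarrow> fst (c ! i) \<inter> e \<noteq> {} \<Longrightarrow> fst (c ! i) \<noteq> e \<Longrightarrow> i \<notin> W \<and> Suc i \<notin> W"
      "\<And>i. i < length c \<Longrightarrow> fst (c ! i) \<inter> e = {} \<Longrightarrow> i \<in> W \<longleftrightarrow> Suc i \<in> W"
      by (rule cancelled_window[OF e[THEN conjunct1] e[THEN conjunct2]]) (rule that; assumption)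
    then have "P e W" unfolding P_def by blast
    then show "\<exists>W. P e W" ..
  qed
  then obtain W where "\<forall>e\<in>B. P e (W e)"
    by (rule bchoice[THEN exE])
  then have W0: "0 \<notin> W e" "length c \<notin> W e"
    and W1: "\<And>i. i < length c \<Longrightarrow> fst (c ! i) = e \<Longrightarrow> snd (c ! i) = 1 \<and> (i \<in> W e \<longleftrightarrow> Suc i \<notin> W e)"
    and W2: "\<And>i. i < length c \<Longrightarrow> fst (c ! i) \<inter> e \<noteq> {} \<Longrightarrow> fst (c ! i) \<noteq> e \<Longrightarrow> i \<notin> W e \<and> Suc i \<notin> W e"
    and W3: "\<And>i. i < length c \<Longrightarrow> fst (c ! i) \<inter> e = {} \<Longrightarrow> i \<in> W e \<longleftrightarrow> Suc i \<in> W e"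
    if "e \<in> B" for e
    using that unfolding P_def by blast+
  define cl where "cl = {w. (\<lambda>x y. {x, y} \<in> fst ` set c - B)\<^sup>*\<^sup>* v w}"
  \<comment> \<open>The invariant of a trajectory at \<open>x\<close> in slot \<open>j\<close>:
    either it is on an excursion over some \<open>e\<close> in \<open>B\<close>, and the other
    endpoint of \<open>e\<close> is in the cluster, or \<open>j\<close> is in no window of an edge
    at \<open>x\<close>, and \<open>x\<close> itself is in the cluster.\<close>
  define inv where "inv = (\<lambda>x j. (\<exists>e\<in>B. x \<in> e \<and> j \<in> W e \<and> other_end e x \<in> cl) \<or>
      (x \<in> cl \<and> (\<forall>e\<in>B. x \<in> e \<longrightarrow> j \<notin> W e)))"
  \<comment> \<open>A link away from \<open>x\<close> differs from every \<open>e\<close> at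
    \<open>x\<close>. If it is disjoint from \<open>e\<close>, window membership does not change;
    otherwise both adjacent slots are outside the window. The unordered pair \<open>{j, j'}\<close>
    covers both time directions.\<close>
  have skip: "inv x j'" if "inv x j" "i < length c" "x \<notin> fst (c ! i)" "{j, j'} = {i, Suc i}" for x i j j'
  proof -
    have "j \<in> W e \<longleftrightarrow> j' \<in> W e" if "e \<in> B" "x \<in> e" for e
    proof -
      have "fst (c ! i) \<noteq> e" using \<open>x \<notin> fst (c ! i)\<close> that by auto
      then show ?thesis
        using W2[OF \<open>e \<in> B\<close> \<open>i < length c\<close>] W3[OF \<open>e \<in> B\<close> \<open>i < length c\<close>] \<open>{j, j'} = {i, Suc i}\<close>
        by (cases "fst (c ! i) \<inter> e = {}") (auto simp: doubleton_eq_iff)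
    qed
    then show ?thesis using \<open>inv x j\<close> unfolding inv_def by blast
  qed
  \<comment> \<open>Following a link at \<open>x\<close>: a cross leads to the slot
    \<open>j'\<close> on its other side, a double bar back into \<open>j\<close>.\<close>
  have use: "if s = 1 then inv (other_end g x) j' else inv (other_end g x) j"
    if inv: "inv x j" and i: "i < length c" and g: "c ! i = (g, s)" "x \<in> g"
      and j: "{j, j'} = {i, Suc i}" for x i j j' g s
  proof -
    have gc: "(g, s) \<in> set c" using i g by (metis nth_mem)
    then obtain z where z: "g = {x, z}" "x \<noteq> z"
      using edges[OF gc] g(2) by (auto simp: insert_commute)
    have oe: "other_end g x = z" "other_end g z = x"
      using other_end_doubleton[OF z(2)] z(1) by auto
    have zg: "z \<in> g" using z by simp
    show ?thesis
    proof (cases "g \<in> B")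
      case True
      then have s: "s = 1" and jj: "j \<in> W g \<longleftrightarrow> j' \<notin> W g"
        using W1[OF True i] g j by (auto simp: doubleton_eq_iff)
      \<comment> \<open>Edges of \<open>B\<close> are disjoint, so \<open>g\<close> alone decides
        which clause of the invariant applies at \<open>x\<close> and \<open>z\<close>; crossing
        \<open>g\<close> enters or leaves its window.\<close>
      have uniq: "e = g" if "e \<in> B" "x \<in> e \<or> z \<in> e" for e
        using disj[OF that(1) True] that(2) z by auto
      show ?thesis
      proof (cases "j \<in> W g")
        case True
        then have "other_end g x \<in> cl" using inv uniq g(2) \<open>g \<in> B\<close> unfolding inv_def by blast
        then have "z \<in> cl" using oe by simp
        then have "inv z j'" unfolding inv_def using uniq jj True by blast
        then show ?thesis using s z oe by simp
      next
        case False
        then have "x \<in> cl" using inv uniq unfolding inv_def by blast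
        then have "other_end g z \<in> cl" using oe by simp
        then have "inv z j'" unfolding inv_def using jj False \<open>g \<in> B\<close> zg by blast
        then show ?thesis using s z oe by simp
      qed
    next
      case False
      \<comment> \<open>A link outside \<open>B\<close> that touches \<open>e\<close> is not
        adjacent to any slot in the window of \<open>e\<close>, so only cluster membership matters
        at both endpoints, and the usable edge \<open>g\<close> joins them.\<close>
      have no: "j \<notin> W e \<and> j' \<notin> W e" if "e \<in> B" "x \<in> e \<or> z \<in> e" for e
      proof -
        have "fst (c ! i) \<inter> e \<noteq> {}" "fst (c ! i) \<noteq> e" using g z that False by auto
        then show ?thesis using W2[OF that(1) i] j by (auto simp: doubleton_eq_iff)
      qed
      then have "x \<in> cl" using inv unfolding inv_def by blast
      moreover have "{x, z} \<in> fst ` set c - B" using gc z False by force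
      ultimately have "z \<in> cl" unfolding cl_def
        by (auto intro: rtranclp.rtrancl_into_rtrancl)
      then show ?thesis using no z oe unfolding inv_def by auto
    qed
  qed
  define Inv where "Inv = (\<lambda>(x, j, up :: bool). j \<le> length c \<and> inv x j)"
  \<comment> \<open>Slots \<open>0\<close> and \<open>length c\<close> are glued at time 0 and lie
    in no window, so wrapping around preserves the invariant, and a visit to \<open>w\<close> in
    slot \<open>0\<close> puts \<open>w\<close> into the cluster.\<close>
  have ends: "inv x 0 \<longleftrightarrow> x \<in> cl" "inv x (length c) \<longleftrightarrow> x \<in> cl" for x
    unfolding inv_def using W0 by auto
  have step: "Inv (loop_step c st)" if Inv: "Inv st" for st
  proof -
    obtain x j up where st: "st = (x, j, up)" by (cases st) auto
    have ij: "inv x j" "j \<le> length c" using Inv st by (auto simp: Inv_def)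
    show ?thesis
    proof (cases up)
      case True
      show ?thesis
      proof (cases "j = length c")
        case True
        then show ?thesis using st ij \<open>up\<close> ends by (auto simp: loop_step_def Inv_def)
      next
        case False
        then have j: "j < length c" using ij by simp
        obtain g s where g: "c ! j = (g, s)" by fastforce
        show ?thesis
          using skip[OF ij(1) j, of "Suc j"] use[OF ij(1) j g, of "Suc j"] st g j \<open>up\<close>
          by (auto simp: loop_step_def Inv_def split: if_splits)
      qed
    next
      case False
      show ?thesis
      proof (cases "j = 0")
        case True
        then show ?thesis using st ij False ends by (auto simp: loop_step_def Inv_def)
      next
        case False
        then obtain i where i: "j = Suc i" "i < length c" using ij by (cases j) auto
        obtain g s where g: "c ! i = (g, s)" by fastforce
        show ?thesis
          using skip[OF ij(1) i(2), of "i"] use[OF ij(1) i(2) g, of i] st g i \<open>\<not> up\<close>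
          by (auto simp: loop_step_def Inv_def insert_commute split: if_splits)
      qed
    qed
  qed
  obtain k d where kd: "(loop_step c ^^ k) (v, 0, True) = (w, 0, d)"
    using \<open>loop_conn c v w\<close> by (auto simp: loop_conn_def)
  have "Inv ((loop_step c ^^ k) (v, 0, True))"
  proof (induction k)
    case 0
    then show ?case using ends by (auto simp: Inv_def cl_def)
  qed (auto intro: step)
  then have "w \<in> cl" using kd ends by (simp add: Inv_def)
  then show ?thesis by (simp add: cl_def)
qed

section \<open>The law of the random links\<close>

definition type_prob :: "real \<Rightarrow> 'e \<times> int \<Rightarrow> real" where
  "type_prob u l = (if snd l = 1 then u else 1 - u)"

text \<open>If the outcome \<open>x\<close> determines the intermediate value \<open>y0\<close>, the
  mixture has a single term.\<close>

lemma pmf_bind_eq_mult: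
  assumes "\<And>y. y \<in> set_pmf M \<Longrightarrow> y \<noteq> y0 \<Longrightarrow> pmf (f y) x = 0"
  shows "pmf (bind_pmf M f) x = pmf M y0 * pmf (f y0) x"
proof -
  have "pmf (bind_pmf M f) x = (\<integral>y. indicator {y0} y * pmf (f y0) x \<partial>measure_pmf M)"
    unfolding pmf_bind using assms
    by (intro integral_cong_AE) (auto simp: AE_measure_pmf_iff split: split_indicator)
  then show ?thesis by (simp add: measure_pmf_single)
qed

lemma set_loop_measure:
  assumes "finite S" "c \<in> set_pmf (loop_measure \<beta> u S)"
  shows "set c \<subseteq> S \<times> {1, -1}"
proof -
  obtain N es s where es: "es \<in> set_pmf (pmf_of_set (permutations_of_multiset (\<Sum>e\<in>S. replicate_mset (N e) e)))"
    and c: "c = map (\<lambda>i. (es ! i, if s i then 1 else -1)) [0..<length es]"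
    using assms(2) by (auto simp: loop_measure_def)
  from es have "mset es = (\<Sum>e\<in>S. replicate_mset (N e) e)"
    by (auto dest: permutations_of_multisetD)
  then have "set_mset (mset es) = set_mset (\<Sum>e\<in>S. replicate_mset (N e) e)" by simp
  also have "\<dots> \<subseteq> S"
    using assms(1) by (auto simp: set_mset_sum split: if_splits)
  finally have "set es \<subseteq> S" by simp
  then show ?thesis unfolding c by (auto simp: set_conv_nth)
qed

text \<open>The factorials in the Poisson weights cancel against the multinomial number of
  orderings, which leaves a weight depending only on the length and the types.\<close>

lemma pmf_loop_measure:
  assumes S: "finite S" and \<beta>: "0 < \<beta>" and u: "0 \<le> u" "u \<le> 1" and c: "set c \<subseteq> S \<times> {1, -1}"
  shows "pmf (loop_measure \<beta> u S) c
    = exp (-\<beta>) ^ card S * \<beta> ^ length c / fact (length c) * (\<Prod>l\<leftarrow>c. type_prob u l)"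
proof -
  \<comment> \<open>\<open>N0\<close>, \<open>es0\<close> and \<open>s0\<close> are the only counts,
    order and types that produce \<open>c\<close>. Beyond \<open>n\<close>, \<open>s0\<close> must
    take the default value \<open>False\<close> of \<open>Pi_pmf\<close>; likewise \<open>N0\<close>
    vanishes outside \<open>S\<close>.\<close>
  define n where "n = length c"
  define es0 where "es0 = map fst c"
  define N0 where "N0 = count (mset es0)"
  define s0 where "s0 = (\<lambda>i. i < n \<and> snd (c ! i) = 1)"
  define third where "third = (\<lambda>es :: 'a list. do {
     s \<leftarrow> Pi_pmf {..<length es} False (\<lambda>_. bernoulli_pmf u);
     return_pmf (map (\<lambda>i. (es ! i, if s i then 1 else -1 :: int)) [0..<length es]) })"
  define second where "second = (\<lambda>N :: 'a \<Rightarrow> nat. do {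
     es \<leftarrow> pmf_of_set (permutations_of_multiset (\<Sum>e\<in>S. replicate_mset (N e) e)); third es })"
  have loop: "loop_measure \<beta> u S = bind_pmf (Pi_pmf S 0 (\<lambda>_. poisson_pmf \<beta>)) second"
    by (simp add: loop_measure_def second_def third_def)
  have len: "length es0 = n" by (simp add: es0_def n_def)
  have set_es0: "set es0 \<subseteq> S" using c by (auto simp: es0_def)
  have M0: "(\<Sum>e\<in>S. replicate_mset (N0 e) e) = mset es0"
    using S set_es0 by (auto simp: multiset_eq_iff N0_def count_sum if_distrib sum.delta cong: if_cong)
  have third_fst: "map fst c' = es" if "c' \<in> set_pmf (third es)" for c' es
    using that by (auto simp: third_def intro: nth_equalityI)
  have second_fst: "mset (map fst c') = (\<Sum>e\<in>S. replicate_mset (N e) e)"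
    if c': "c' \<in> set_pmf (second N)" for c' N
  proof -
    obtain es where "es \<in> permutations_of_multiset (\<Sum>e\<in>S. replicate_mset (N e) e)" "c' \<in> set_pmf (third es)"
      using c' by (auto simp: second_def)
    then show ?thesis using third_fst by (metis permutations_of_multisetD)
  qed
  have "pmf (third es0) c = pmf (Pi_pmf {..<n} False (\<lambda>_. bernoulli_pmf u)) s0 *
      pmf (return_pmf (map (\<lambda>i. (es0 ! i, if s0 i then 1 else -1 :: int)) [0..<length es0])) c"
    unfolding third_def len
  proof (rule pmf_bind_eq_mult)
    fix s assume "s \<in> set_pmf (Pi_pmf {..<n} False (\<lambda>_. bernoulli_pmf u))" "s \<noteq> s0"
    then have *: "\<not> s i" if "i \<ge> n" for i
      using that set_Pi_pmf_subset[of "{..<n}" False "\<lambda>_. bernoulli_pmf u"] by auto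
    have "c \<noteq> map (\<lambda>i. (es0 ! i, if s i then 1 else -1 :: int)) [0..<n]" (is "_ \<noteq> ?c'")
    proof
      assume eq: "c = ?c'"
      have "snd (c ! i) = (if s i then 1 else -1)" if "i < n" for i
        using that by (subst eq) simp
      then have "s i = s0 i" for i
        using * by (cases "i < n") (auto simp: s0_def split: if_splits)
      with \<open>s \<noteq> s0\<close> show False by auto
    qed
    then show "pmf (return_pmf (map (\<lambda>i. (es0 ! i, if s i then 1 else -1 :: int)) [0..<n])) c = 0"
      by simp
  qed
  also have "map (\<lambda>i. (es0 ! i, if s0 i then 1 else -1 :: int)) [0..<length es0] = c"
  proof (rule nth_equalityI)
    fix i assume "i < length (map (\<lambda>i. (es0 ! i, if s0 i then 1 else -1 :: int)) [0..<length es0])"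
    then have i: "i < n" by (simp add: len)
    then have "c ! i \<in> S \<times> {1, -1}" using c nth_mem by (auto simp: n_def)
    then show "map (\<lambda>i. (es0 ! i, if s0 i then 1 else -1 :: int)) [0..<length es0] ! i = c ! i"
      using i len by (cases "c ! i") (auto simp: s0_def es0_def n_def)
  qed (simp add: len n_def)
  also have "pmf (Pi_pmf {..<n} False (\<lambda>_. bernoulli_pmf u)) s0 = (\<Prod>i<n. type_prob u (c ! i))"
    using u by (subst pmf_Pi') (auto simp: s0_def type_prob_def intro!: prod.cong)
  also have "\<dots> = (\<Prod>l\<leftarrow>c. type_prob u l)"
    unfolding n_def by (induction c) (simp_all add: prod.lessThan_Suc_shift del: prod.lessThan_Suc)
  finally have 3: "pmf (third es0) c = (\<Prod>l\<leftarrow>c. type_prob u l)" by simp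
  have "pmf (second N0) c
      = pmf (pmf_of_set (permutations_of_multiset (\<Sum>e\<in>S. replicate_mset (N0 e) e))) es0 * pmf (third es0) c"
    unfolding second_def
    by (rule pmf_bind_eq_mult) (use third_fst in \<open>auto simp: pmf_eq_0_set_pmf es0_def\<close>)
  also have "pmf (pmf_of_set (permutations_of_multiset (\<Sum>e\<in>S. replicate_mset (N0 e) e))) es0
      = 1 / real (card (permutations_of_multiset (mset es0)))"
    unfolding M0 by (subst pmf_of_set) (auto simp: indicator_def permutations_of_multisetI)
  finally have 2: "pmf (second N0) c
      = 1 / real (card (permutations_of_multiset (mset es0))) * (\<Prod>l\<leftarrow>c. type_prob u l)" by (simp add: 3)
  have "pmf (loop_measure \<beta> u S) c = pmf (Pi_pmf S 0 (\<lambda>_. poisson_pmf \<beta>)) N0 * pmf (second N0) c"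
    unfolding loop
  proof (rule pmf_bind_eq_mult)
    fix N assume "N \<in> set_pmf (Pi_pmf S 0 (\<lambda>_. poisson_pmf \<beta>))" "N \<noteq> N0"
    then have N: "N e = 0" if "e \<notin> S" for e
      using that set_Pi_pmf_subset[OF S, of 0 "\<lambda>_. poisson_pmf \<beta>"] by auto
    have "c \<notin> set_pmf (second N)"
    proof
      assume "c \<in> set_pmf (second N)"
      then have "mset es0 = (\<Sum>e\<in>S. replicate_mset (N e) e)" using second_fst by (simp add: es0_def)
      then have "N0 e = N e" for e
        using S N by (cases "e \<in> S") (auto simp: N0_def count_sum sum.delta cong: if_cong)
      with \<open>N \<noteq> N0\<close> show False by auto
    qed
    then show "pmf (second N) c = 0" by (simp add: pmf_eq_0_set_pmf)
  qed
  also have "pmf (Pi_pmf S 0 (\<lambda>_. poisson_pmf \<beta>)) N0 = (\<Prod>e\<in>S. \<beta> ^ N0 e / fact (N0 e) * exp (-\<beta>))"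
    using \<beta> S set_es0 by (subst pmf_Pi') (auto simp: N0_def count_eq_zero_iff)
  also have "\<dots> = exp (-\<beta>) ^ card S * \<beta> ^ n / (\<Prod>e\<in>S. fact (N0 e))"
  proof -
    have n: "(\<Sum>e\<in>S. N0 e) = n"
      using sum.mono_neutral_left[OF S set_es0, of N0] size_multiset_overloaded_eq[of "mset es0"] len
      by (simp add: N0_def not_in_iff[symmetric])
    show ?thesis by (simp add: prod.distrib prod_dividef power_sum flip: n)
  qed
  finally have 1: "pmf (loop_measure \<beta> u S) c
      = exp (-\<beta>) ^ card S * \<beta> ^ n / (\<Prod>e\<in>S. fact (N0 e)) * pmf (second N0) c" .
  have "(\<Prod>e\<in>S. fact (N0 e) :: real) * real (card (permutations_of_multiset (mset es0))) = fact n"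
  proof -
    have "(\<Prod>e\<in>S. fact (N0 e) :: nat) = (\<Prod>e\<in>set es0. fact (N0 e))"
    proof (rule prod.mono_neutral_right[OF S set_es0])
      show "\<forall>e\<in>S - set es0. fact (N0 e) = (1 :: nat)"
      proof
        fix e assume "e \<in> S - set es0"
        then have "N0 e = 0" by (simp add: N0_def count_eq_zero_iff)
        then show "fact (N0 e) = (1 :: nat)" by simp
      qed
    qed
    then have "card (permutations_of_multiset (mset es0)) * (\<Prod>e\<in>S. fact (N0 e)) = fact n"
      using card_permutations_of_multiset_aux[of "mset es0"] by (simp add: N0_def len)
    then have "real (card (permutations_of_multiset (mset es0)) * (\<Prod>e\<in>S. fact (N0 e))) = fact n"
      by (metis of_nat_fact)
    then show ?thesis by (simp add: mult.commute)
  qed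
  from this[symmetric] show ?thesis unfolding 1 2 by (simp add: n_def)
qed

text \<open>Independence of the links on disjoint edge sets. A pair \<open>(c1, c2)\<close> arises
  from the shuffles of \<open>c1\<close> and \<open>c2\<close>, all of equal weight; their number is
  a binomial coefficient, which turns the factorial of the total length into the product of the two
  separate ones.\<close>

lemma loop_measure_split:
  assumes fin: "finite S1" "finite S2" and disj: "S1 \<inter> S2 = {}"
    and \<beta>: "0 < \<beta>" and u: "0 \<le> u" "u \<le> 1"
  shows "map_pmf (\<lambda>c. (filter (\<lambda>l. fst l \<in> S1) c, filter (\<lambda>l. fst l \<in> S2) c)) (loop_measure \<beta> u (S1 \<union> S2))
    = pair_pmf (loop_measure \<beta> u S1) (loop_measure \<beta> u S2)" (is "map_pmf ?f ?M = ?R")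
proof (rule pmf_eqI)
  fix cc :: "('a \<times> int) list \<times> ('a \<times> int) list"
  obtain c1 c2 where cc: "cc = (c1, c2)" by fastforce
  define A where "A = ?f -` {(c1, c2)}"
  have finS: "finite (S1 \<union> S2)" using fin by simp
  have lhs: "pmf (map_pmf ?f ?M) cc = measure ?M (A \<inter> set_pmf ?M)"
    by (simp add: pmf_map cc A_def measure_Int_set_pmf)
  show "pmf (map_pmf ?f ?M) cc = pmf ?R cc"
  proof (cases "set c1 \<subseteq> S1 \<times> {1, -1} \<and> set c2 \<subseteq> S2 \<times> {1, -1}")
    case True
    then have 12: "set c1 \<subseteq> S1 \<times> {1, -1}" "set c2 \<subseteq> S2 \<times> {1, -1}" by auto
    have sh: "shuffles c1 c2 \<subseteq> A"
    proof
      fix c assume c: "c \<in> shuffles c1 c2"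
      have "filter (\<lambda>l. fst l \<in> S1) c \<in> shuffles (filter (\<lambda>l. fst l \<in> S1) c1) (filter (\<lambda>l. fst l \<in> S1) c2)"
        using c filter_shuffles by blast
      moreover have "filter (\<lambda>l. fst l \<in> S1) c1 = c1" "filter (\<lambda>l. fst l \<in> S1) c2 = []"
        using 12 disj by (auto simp: filter_id_conv filter_empty_conv)
      moreover have "filter (\<lambda>l. fst l \<in> S2) c \<in> shuffles (filter (\<lambda>l. fst l \<in> S2) c1) (filter (\<lambda>l. fst l \<in> S2) c2)"
        using c filter_shuffles by blast
      moreover have "filter (\<lambda>l. fst l \<in> S2) c1 = []" "filter (\<lambda>l. fst l \<in> S2) c2 = c2"
        using 12 disj by (auto simp: filter_id_conv filter_empty_conv)
      ultimately show "c \<in> A" by (simp add: A_def)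
    qed
    \<comment> \<open>On the support every link lies on \<open>S1\<close> or \<open>S2\<close>, so a
      configuration is a shuffle of its two restrictions.\<close>
    have sub: "A \<inter> set_pmf ?M \<subseteq> shuffles c1 c2"
    proof
      fix c assume c: "c \<in> A \<inter> set_pmf ?M"
      then have "set c \<subseteq> (S1 \<union> S2) \<times> {1, -1}" using set_loop_measure[OF finS] by blast
      then have "filter (\<lambda>l. fst l \<notin> S1) c = filter (\<lambda>l. fst l \<in> S2) c"
        using disj by (intro filter_cong) auto
      then show "c \<in> shuffles c1 c2"
        using partition_in_shuffles[of c "\<lambda>l. fst l \<in> S1"] c by (auto simp: A_def)
    qed
    have "measure ?M (A \<inter> set_pmf ?M) = measure ?M (shuffles c1 c2)"
      using sh sub by (intro measure_prob_cong_0) (auto simp: set_pmf_iff)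
    also have "\<dots> = (\<Sum>c\<in>shuffles c1 c2. pmf ?M c)"
      by (simp add: measure_measure_pmf_finite)
    also have "\<dots> = (\<Sum>c\<in>shuffles c1 c2. exp (-\<beta>) ^ card (S1 \<union> S2) * \<beta> ^ (length c1 + length c2)
        / fact (length c1 + length c2) * ((\<Prod>l\<leftarrow>c1. type_prob u l) * (\<Prod>l\<leftarrow>c2. type_prob u l)))"
    proof (rule sum.cong[OF refl])
      fix c assume c: "c \<in> shuffles c1 c2"
      have "set c \<subseteq> (S1 \<union> S2) \<times> {1, -1}" using set_shuffles[OF c] 12 by auto
      moreover have "(\<Prod>l\<leftarrow>c. type_prob u l) = (\<Prod>l\<leftarrow>c1. type_prob u l) * (\<Prod>l\<leftarrow>c2. type_prob u l)"
      proof -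
        have "(\<Prod>l\<leftarrow>c. type_prob u l) = prod_mset (image_mset (type_prob u) (mset c))"
          by (metis mset_map prod_mset_prod_list)
        also have "\<dots> = prod_mset (image_mset (type_prob u) (mset c1)) * prod_mset (image_mset (type_prob u) (mset c2))"
          using mset_shuffles[OF c] by simp
        finally show ?thesis by (metis mset_map prod_mset_prod_list)
      qed
      ultimately show "pmf ?M c = exp (-\<beta>) ^ card (S1 \<union> S2) * \<beta> ^ (length c1 + length c2)
        / fact (length c1 + length c2) * ((\<Prod>l\<leftarrow>c1. type_prob u l) * (\<Prod>l\<leftarrow>c2. type_prob u l))"
        using length_shuffles[OF c] pmf_loop_measure[OF finS \<beta> u, of c] by simp
    qed
    also have "\<dots> = real (card (shuffles c1 c2)) * (exp (-\<beta>) ^ card (S1 \<union> S2) * \<beta> ^ (length c1 + length c2)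
        / fact (length c1 + length c2) * ((\<Prod>l\<leftarrow>c1. type_prob u l) * (\<Prod>l\<leftarrow>c2. type_prob u l)))"
      by simp
    also have "real (card (shuffles c1 c2)) = fact (length c1 + length c2) / (fact (length c1) * fact (length c2))"
    proof -
      \<comment> \<open>Without common links, different interleavings give different lists.\<close>
      have "set c1 \<inter> set c2 = {}" using 12 disj by fastforce
      then show ?thesis by (simp add: card_disjoint_shuffles binomial_fact)
    qed
    also have "fact (length c1 + length c2) / (fact (length c1) * fact (length c2)) *
        (exp (-\<beta>) ^ card (S1 \<union> S2) * \<beta> ^ (length c1 + length c2)
        / fact (length c1 + length c2) * ((\<Prod>l\<leftarrow>c1. type_prob u l) * (\<Prod>l\<leftarrow>c2. type_prob u l)))
      = pmf (loop_measure \<beta> u S1) c1 * pmf (loop_measure \<beta> u S2) c2"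
      using 12 fin disj \<beta> u
      by (simp add: pmf_loop_measure card_Un_disjoint power_add field_simps)
    finally show ?thesis unfolding lhs by (simp add: cc pmf_pair)
  next
    case False
    have "A \<inter> set_pmf ?M = {}"
    proof (rule ccontr)
      assume "A \<inter> set_pmf ?M \<noteq> {}"
      then obtain c where c: "c \<in> set_pmf ?M" "c1 = filter (\<lambda>l. fst l \<in> S1) c" "c2 = filter (\<lambda>l. fst l \<in> S2) c"
        by (auto simp: A_def)
      then show False using set_loop_measure[OF finS c(1)] False by auto
    qed
    moreover have "pmf (loop_measure \<beta> u S1) c1 = 0 \<or> pmf (loop_measure \<beta> u S2) c2 = 0"
      using False set_loop_measure[OF fin(1), of c1] set_loop_measure[OF fin(2), of c2]
      unfolding pmf_eq_0_set_pmf by blast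
    ultimately show ?thesis unfolding lhs by (auto simp: cc pmf_pair)
  qed
qed

lemma prob_loop_measure_split:
  assumes fin: "finite S1" "finite S2" and disj: "S1 \<inter> S2 = {}"
    and \<beta>: "0 < \<beta>" and u: "0 \<le> u" "u \<le> 1"
  shows "measure_pmf.prob (loop_measure \<beta> u (S1 \<union> S2))
      {c. P (filter (\<lambda>l. fst l \<in> S1) c) \<and> Q (filter (\<lambda>l. fst l \<in> S2) c)}
    = measure_pmf.prob (loop_measure \<beta> u S1) {c. P c} * measure_pmf.prob (loop_measure \<beta> u S2) {c. Q c}"
proof -
  let ?f = "\<lambda>c :: ('a \<times> int) list. (filter (\<lambda>l. fst l \<in> S1) c, filter (\<lambda>l. fst l \<in> S2) c)"
  \<comment> \<open>Intersecting with the supports makes both sets countable, as the product rule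
    for \<open>pair_pmf\<close> requires.\<close>
  let ?A = "{c. P c} \<inter> set_pmf (loop_measure \<beta> u S1)" and ?B = "{c. Q c} \<inter> set_pmf (loop_measure \<beta> u S2)"
  let ?R = "pair_pmf (loop_measure \<beta> u S1) (loop_measure \<beta> u S2)"
  have "measure_pmf.prob (loop_measure \<beta> u (S1 \<union> S2))
      {c. P (filter (\<lambda>l. fst l \<in> S1) c) \<and> Q (filter (\<lambda>l. fst l \<in> S2) c)}
    = measure_pmf.prob (map_pmf ?f (loop_measure \<beta> u (S1 \<union> S2))) ({c. P c} \<times> {c. Q c})"
    by (auto intro!: arg_cong2[of _ _ _ _ measure])
  also have "\<dots> = measure_pmf.prob ?R (({c. P c} \<times> {c. Q c}) \<inter> set_pmf ?R)"
    unfolding loop_measure_split[OF assms] by (simp only: measure_Int_set_pmf)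
  also have "({c. P c} \<times> {c. Q c}) \<inter> set_pmf ?R = ?A \<times> ?B" by auto
  also have "measure_pmf.prob ?R \<dots> = measure_pmf.prob (loop_measure \<beta> u S1) ?A * measure_pmf.prob (loop_measure \<beta> u S2) ?B"
    by (rule measure_pmf_prob_product) (auto intro: countable_subset[OF Int_lower2])
  finally show ?thesis by (simp only: measure_Int_set_pmf)
qed

lemma prob_cong_set_pmf:
  assumes "\<And>c. c \<in> set_pmf M \<Longrightarrow> P c \<longleftrightarrow> Q c"
  shows "measure_pmf.prob M {c. P c} = measure_pmf.prob M {c. Q c}"
  using assms by (intro measure_prob_cong_0) (auto simp: set_pmf_iff)

text \<open>A Poisson count vanishes with probability \<open>exp (-\<beta>)\<close>; splitting off
  one edge at a time gives the product form.\<close>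

lemma prob_loop_measure_support:
  assumes "finite S" and \<beta>: "0 < \<beta>" and u: "0 \<le> u" "u \<le> 1" and "A \<subseteq> S"
  shows "measure_pmf.prob (loop_measure \<beta> u S) {c. fst ` set c = A}
    = bern_weight (\<lambda>_. 1 - exp (-\<beta>)) S A"
  using assms(1,5)
proof (induction S arbitrary: A rule: finite_induct)
  case empty
  have "measure_pmf.prob (loop_measure \<beta> u ({} :: 'a set)) {c. fst ` set c = A} = pmf (loop_measure \<beta> u ({} :: 'a set)) []"
    using empty by (simp add: measure_pmf_single[symmetric])
  then show ?case using pmf_loop_measure[OF _ \<beta> u, of "{} :: 'a set" "[]"] empty by (simp add: bern_weight_def)
next
  case (insert e S)
  have nil: "measure_pmf.prob (loop_measure \<beta> u {e}) {c. c = []} = exp (-\<beta>)"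
    using pmf_loop_measure[OF _ \<beta> u, of "{e}" "[]"] by (simp add: measure_pmf_single)
  then have not_nil: "measure_pmf.prob (loop_measure \<beta> u {e}) {c. c \<noteq> []} = 1 - exp (-\<beta>)"
    using measure_pmf.prob_compl[of "{c. c = []}" "loop_measure \<beta> u {e}"]
    by (simp add: Collect_neg_eq Compl_eq_Diff_UNIV)
  have fin: "finite (insert e S)" using insert by simp
  have eq: "fst ` set c = A \<longleftrightarrow> (filter (\<lambda>l. fst l \<in> {e}) c \<noteq> [] \<longleftrightarrow> e \<in> A) \<and>
      fst ` set (filter (\<lambda>l. fst l \<in> S) c) = A - {e}"
    if c: "c \<in> set_pmf (loop_measure \<beta> u ({e} \<union> S))" for c
  proof -
    have "set c \<subseteq> insert e S \<times> {1, -1}" using set_loop_measure[OF fin, of c \<beta> u] c by simp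
    then have "fst ` set c \<subseteq> insert e S" by fastforce
    moreover have "filter (\<lambda>l. fst l \<in> {e}) c \<noteq> [] \<longleftrightarrow> e \<in> fst ` set c"
      by (auto simp: filter_empty_conv)
    moreover have "fst ` set (filter (\<lambda>l. fst l \<in> S) c) = fst ` set c \<inter> S" by auto
    moreover have "X = A \<longleftrightarrow> (e \<in> X \<longleftrightarrow> e \<in> A) \<and> X \<inter> S = A - {e}" if "X \<subseteq> insert e S" for X
      using that insert.hyps insert.prems by blast
    ultimately show ?thesis by metis
  qed
  have "measure_pmf.prob (loop_measure \<beta> u ({e} \<union> S)) {c. fst ` set c = A}
    = measure_pmf.prob (loop_measure \<beta> u ({e} \<union> S)) {c. (filter (\<lambda>l. fst l \<in> {e}) c \<noteq> [] \<longleftrightarrow> e \<in> A) \<and>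
      fst ` set (filter (\<lambda>l. fst l \<in> S) c) = A - {e}}"
    using eq by (rule prob_cong_set_pmf)
  also have "\<dots> = measure_pmf.prob (loop_measure \<beta> u {e}) {c. c \<noteq> [] \<longleftrightarrow> e \<in> A} *
      measure_pmf.prob (loop_measure \<beta> u S) {c. fst ` set c = A - {e}}"
    using insert.hyps by (intro prob_loop_measure_split \<beta> u) auto
  also have "measure_pmf.prob (loop_measure \<beta> u S) {c. fst ` set c = A - {e}}
      = bern_weight (\<lambda>_. 1 - exp (-\<beta>)) S (A - {e})"
    using insert by (intro insert.IH) auto
  finally have *: "measure_pmf.prob (loop_measure \<beta> u ({e} \<union> S)) {c. fst ` set c = A}
    = measure_pmf.prob (loop_measure \<beta> u {e}) {c. c \<noteq> [] \<longleftrightarrow> e \<in> A} *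
      bern_weight (\<lambda>_. 1 - exp (-\<beta>)) S (A - {e})" .
  show ?case
  proof (cases "e \<in> A")
    case True
    then have "insert e (A - {e}) = A" "A - {e} \<subseteq> S" using insert.prems by auto
    then show ?thesis
      using * True not_nil bern_weight_insert_in[OF insert.hyps, of "A - {e}" "\<lambda>_. 1 - exp (-\<beta>)"] by simp
  next
    case False
    then have "A - {e} = A" "A \<subseteq> S" using insert.prems by auto
    then show ?thesis
      using * False nil bern_weight_insert_out[OF insert.hyps, of A "\<lambda>_. 1 - exp (-\<beta>)"] by simp
  qed
qed

section \<open>Counting configurations with a cancelled edge\<close>

lemma listset_iff: "xs \<in> listset As \<longleftrightarrow> list_all2 (\<in>) xs As"
  by (induction As arbitrary: xs) (auto simp: set_Cons_def list_all2_Cons2)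

lemma listset_Cons_image: "listset (A # As) = (\<lambda>(x, xs). x # xs) ` (A \<times> listset As)"
  by (auto simp: set_Cons_def image_iff)

lemma finite_listset: "(\<And>A. A \<in> set As \<Longrightarrow> finite A) \<Longrightarrow> finite (listset As)"
  by (induction As) (simp_all add: listset_Cons_image del: listset.simps(2))

lemma sum_prod_list_listset:
  fixes f :: "'a \<Rightarrow> 'b::comm_semiring_1"
  shows "(\<Sum>xs\<in>listset As. prod_list (map f xs)) = (\<Prod>A\<leftarrow>As. sum f A)"
proof (induction As)
  case (Cons A As)
  have "(\<Sum>xs\<in>listset (A # As). prod_list (map f xs))
      = (\<Sum>(x, xs)\<in>A \<times> listset As. f x * prod_list (map f xs))"
    unfolding listset_Cons_image by (subst sum.reindex, auto simp: inj_on_def intro!: sum.cong)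
  then show ?case
    by (simp add: Cons.IH[symmetric] sum_product sum.cartesian_product)
qed simp

text \<open>The configurations counted here have exactly two links on \<open>e\<close>, both crosses and consecutive,
  and one link on each other element of \<open>A\<close>.\<close>
lemma prob_cancelled_ge:
  assumes S: "finite S" and \<beta>: "0 < \<beta>" and u: "0 \<le> u" "u \<le> 1"
    and e: "e \<in> A" and A: "A \<subseteq> S" and near: "\<And>g. g \<in> S \<Longrightarrow> g \<inter> e \<noteq> {}"
  shows "\<beta> * u\<^sup>2 * (\<beta> / (exp \<beta> - 1)) ^ card A / (real (card A) + 1) *
      measure_pmf.prob (loop_measure \<beta> u S) {c. fst ` set c = A}
    \<le> measure_pmf.prob (loop_measure \<beta> u S) {c. fst ` set c = A \<and> cancelled c e}"
proof -
  define k where "k = card A"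
  \<comment> \<open>\<open>dup \<sigma>\<close> is the order of the edges with \<open>e\<close>
    doubled in place; \<open>L \<sigma>\<close> adds the types, crosses on \<open>e\<close> and
    arbitrary ones elsewhere.\<close>
  define dup where "dup = (\<lambda>\<sigma>. concat (map (\<lambda>g. if g = e then [e, e] else [g]) \<sigma>))"
  define types where "types = (\<lambda>g. if g = e then {(e, 1 :: int)} else {(g, 1), (g, -1)})"
  define L where "L = (\<lambda>\<sigma>. listset (map types (dup \<sigma>)))"
  have finA: "finite A" using S A finite_subset by auto
  have L_iff: "c \<in> L \<sigma> \<longleftrightarrow> list_all2 (\<lambda>x g. x \<in> types g) c (dup \<sigma>)" for c \<sigma>
    by (simp add: L_def listset_iff list_all2_map2)
  have fst_L: "map fst c = dup \<sigma>" if "c \<in> L \<sigma>" for c \<sigma>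
  proof -
    have "list_all2 (\<lambda>x g. x \<in> types g) c (dup \<sigma>)"
      using that by (simp only: L_iff)
    then have "list_all2 (\<lambda>x g. fst x = g) c (dup \<sigma>)"
      by (rule list_all2_mono) (auto simp: types_def split: if_splits)
    then show ?thesis by (simp add: list_all2_map1[symmetric, of "(=)"] list.rel_eq)
  qed
  have set_dup: "set (dup \<sigma>) = set \<sigma>" for \<sigma>
    by (induction \<sigma>) (auto simp: dup_def)
  \<comment> \<open>\<open>\<sigma>\<close> can be recovered, so the sets \<open>L \<sigma>\<close>
    are disjoint for different \<open>\<sigma>\<close>.\<close>
  have remdups_dup: "remdups (dup \<sigma>) = \<sigma>" if "distinct \<sigma>" for \<sigma>
    using that
  proof (induction \<sigma>)
    case (Cons g \<sigma>)
    moreover have "dup (g # \<sigma>) = (if g = e then [e, e] else [g]) @ dup \<sigma>" by (simp add: dup_def)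
    ultimately show ?case using set_dup[of \<sigma>] by auto
  qed (simp add: dup_def)
  have length_dup: "length (dup \<sigma>) = k + 1" if "\<sigma> \<in> permutations_of_set A" for \<sigma>
  proof -
    have d: "distinct \<sigma>" "set \<sigma> = A" using that by (auto simp: permutations_of_set_def)
    have "length (dup \<sigma>) = (\<Sum>g\<leftarrow>\<sigma>. if g = e then 2 else 1)"
      by (induction \<sigma>) (auto simp: dup_def)
    also have "\<dots> = (\<Sum>g\<in>A. if g = e then 2 else 1)"
      using d sum.distinct_set_conv_list[of \<sigma> "\<lambda>g. if g = e then 2 else 1 :: nat"] by metis
    also have "\<dots> = (\<Sum>g\<in>A. 1 + (if g = e then 1 else 0))" by (intro sum.cong) auto
    also have "\<dots> = k + 1" using finA e unfolding sum.distrib by (simp add: k_def)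
    finally show ?thesis .
  qed
  have weight: "(\<Sum>c\<in>L \<sigma>. pmf (loop_measure \<beta> u S) c) = exp (-\<beta>) ^ card S * \<beta> ^ (k + 1) / fact (k + 1) * u\<^sup>2"
    if \<sigma>: "\<sigma> \<in> permutations_of_set A" for \<sigma>
  proof -
    have d: "distinct \<sigma>" "set \<sigma> = A" using \<sigma> by (auto simp: permutations_of_set_def)
    have "(\<Sum>c\<in>L \<sigma>. pmf (loop_measure \<beta> u S) c)
        = (\<Sum>c\<in>L \<sigma>. exp (-\<beta>) ^ card S * \<beta> ^ (k + 1) / fact (k + 1) * prod_list (map (type_prob u) c))"
    proof (rule sum.cong[OF refl])
      fix c assume c: "c \<in> L \<sigma>"
      then have "length c = k + 1" using fst_L[OF c] length_dup[OF \<sigma>] by (metis length_map)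
      moreover have "set c \<subseteq> S \<times> {1, -1}"
      proof
        fix x assume "x \<in> set c"
        then obtain i where i: "i < length c" "x = c ! i" by (metis in_set_conv_nth)
        have "list_all2 (\<lambda>x g. x \<in> types g) c (dup \<sigma>)"
          using c by (simp only: L_iff)
        then have "x \<in> types (dup \<sigma> ! i)" "dup \<sigma> ! i \<in> A"
          using i set_dup[of \<sigma>] d by (auto simp: list_all2_conv_all_nth)
        then show "x \<in> S \<times> {1, -1}" using A by (auto simp: types_def split: if_splits)
      qed
      ultimately show "pmf (loop_measure \<beta> u S) c
          = exp (-\<beta>) ^ card S * \<beta> ^ (k + 1) / fact (k + 1) * prod_list (map (type_prob u) c)"
        using pmf_loop_measure[OF S \<beta> u, of c] by simp
    qed
    also have "\<dots> = exp (-\<beta>) ^ card S * \<beta> ^ (k + 1) / fact (k + 1) * (\<Prod>g\<leftarrow>dup \<sigma>. sum (type_prob u) (types g))"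
      unfolding sum_distrib_left[symmetric] L_def sum_prod_list_listset map_map comp_def ..
    \<comment> \<open>The two types have total probability \<open>1\<close> on every other edge; the
      two forced crosses on \<open>e\<close> contribute \<open>u\<^sup>2\<close>.\<close>
    also have "(\<Prod>g\<leftarrow>dup \<sigma>. sum (type_prob u) (types g)) = (\<Prod>g\<leftarrow>\<sigma>. if g = e then u\<^sup>2 else 1)"
      by (induction \<sigma>) (auto simp: dup_def types_def type_prob_def power2_eq_square)
    also have "\<dots> = (\<Prod>g\<in>A. if g = e then u\<^sup>2 else 1)"
      using d prod.distinct_set_conv_list[of \<sigma>] by metis
    also have "\<dots> = u\<^sup>2" using finA e by (simp add: prod.delta)
    finally show ?thesis .
  qed
  have finL: "finite (L \<sigma>)" for \<sigma>
  proof -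
    have "finite A" if "A \<in> set (map types (dup \<sigma>))" for A
      using that by (auto simp: types_def)
    then show ?thesis unfolding L_def by (rule finite_listset)
  qed
  have canc: "fst ` set c = A \<and> cancelled c e" if \<sigma>: "\<sigma> \<in> permutations_of_set A" and c: "c \<in> L \<sigma>" for \<sigma> c
  proof -
    have d: "distinct \<sigma>" "set \<sigma> = A" using \<sigma> by (auto simp: permutations_of_set_def)
    have set_c: "fst ` set c = A" using fst_L[OF c] set_dup[of \<sigma>] d by (metis set_map)
    obtain as bs where ab: "\<sigma> = as @ e # bs" "e \<notin> set as" "e \<notin> set bs"
      using d e split_list[of e \<sigma>] by auto
    have "dup \<sigma> = dup as @ e # e # dup bs" by (simp add: dup_def ab(1))
    with c have "list_all2 (\<lambda>x g. x \<in> types g) c (dup as @ e # e # dup bs)"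
      by (simp only: L_iff)
    then obtain xs ys where c_eq: "c = xs @ (e, 1) # (e, 1) # ys"
      and "list_all2 (\<lambda>x g. x \<in> types g) xs (dup as)" "list_all2 (\<lambda>x g. x \<in> types g) ys (dup bs)"
      by (auto simp: list_all2_append2 list_all2_Cons2 types_def)
    then have "xs \<in> L as" "ys \<in> L bs" by (simp_all only: L_iff)
    then have "e \<notin> fst ` (set xs \<union> set ys)"
      using fst_L[of xs as] fst_L[of ys bs] set_dup ab by (metis Un_iff image_Un set_map)
    \<comment> \<open>Every edge of \<open>S\<close> meets \<open>e\<close>, so nothing is filtered
      out.\<close>
    moreover have "filter (\<lambda>l. fst l \<inter> e \<noteq> {}) c = c"
      using set_c A near by (auto simp: filter_id_conv)
    ultimately show ?thesis using set_c c_eq by (auto simp: cancelled_def)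
  qed
  \<comment> \<open>The lower bound is exactly the probability of the union of the
    \<open>L \<sigma>\<close>: as \<open>\<beta> / (exp \<beta> - 1)\<close> times
    \<open>1 - exp (-\<beta>)\<close> is \<open>\<beta> * exp (-\<beta>)\<close>, it equals
    \<open>fact k\<close> times the weight of one \<open>L \<sigma>\<close>.\<close>
  have "bern_weight (\<lambda>_. 1 - exp (-\<beta>)) S A = (1 - exp (-\<beta>)) ^ k * exp (-\<beta>) ^ (card S - k)"
    using A finA by (simp add: bern_weight_def k_def card_Diff_subset)
  then have "\<beta> * u\<^sup>2 * (\<beta> / (exp \<beta> - 1)) ^ k / (real k + 1) * measure_pmf.prob (loop_measure \<beta> u S) {c. fst ` set c = A}
      = \<beta> * u\<^sup>2 / (real k + 1) * ((\<beta> / (exp \<beta> - 1)) * (1 - exp (-\<beta>))) ^ k * exp (-\<beta>) ^ (card S - k)"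
    using prob_loop_measure_support[OF S \<beta> u A] by (simp only: power_mult_distrib) (simp add: mult_ac)
  also have "(\<beta> / (exp \<beta> - 1)) * (1 - exp (-\<beta>)) = \<beta> * exp (-\<beta>)"
    using \<beta> by (simp add: exp_minus field_simps)
  also have "\<beta> * u\<^sup>2 / (real k + 1) * (\<beta> * exp (-\<beta>)) ^ k * exp (-\<beta>) ^ (card S - k)
      = \<beta> ^ (k + 1) * u\<^sup>2 / (real k + 1) * exp (-\<beta>) ^ card S"
  proof -
    have "k \<le> card S" unfolding k_def using S A by (rule card_mono)
    then have "exp (-\<beta>) ^ card S = exp (-\<beta>) ^ k * exp (-\<beta>) ^ (card S - k)"
      by (simp flip: power_add)
    then show ?thesis by (simp add: power_mult_distrib)
  qed
  also have "\<dots> = fact k * (exp (-\<beta>) ^ card S * \<beta> ^ (k + 1) / fact (k + 1) * u\<^sup>2)"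
  proof -
    have "a * b / x * c = y * (c * a / (x * y) * b)" if "y \<noteq> 0" for a b c x y :: real
      using that by simp
    moreover have "fact (k + 1) = (real k + 1) * (fact k :: real)" by (simp add: algebra_simps)
    ultimately show ?thesis by (metis fact_nonzero)
  qed
  also have "\<dots> = (\<Sum>\<sigma>\<in>permutations_of_set A. \<Sum>c\<in>L \<sigma>. pmf (loop_measure \<beta> u S) c)"
    using finA by (simp add: weight k_def)
  also have "\<dots> = (\<Sum>c\<in>(\<Union>\<sigma>\<in>permutations_of_set A. L \<sigma>). pmf (loop_measure \<beta> u S) c)"
  proof (rule sum.UNION_disjoint[symmetric])
    show "\<forall>\<sigma>\<in>permutations_of_set A. \<forall>\<tau>\<in>permutations_of_set A. \<sigma> \<noteq> \<tau> \<longrightarrow> L \<sigma> \<inter> L \<tau> = {}"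
    proof (intro ballI impI, rule ccontr)
      fix \<sigma> \<tau> assume *: "\<sigma> \<in> permutations_of_set A" "\<tau> \<in> permutations_of_set A" "\<sigma> \<noteq> \<tau>" "L \<sigma> \<inter> L \<tau> \<noteq> {}"
      then obtain c where "c \<in> L \<sigma>" "c \<in> L \<tau>" by auto
      then have "dup \<sigma> = dup \<tau>" using fst_L by metis
      then show False using * remdups_dup[of \<sigma>] remdups_dup[of \<tau>] by (auto simp: permutations_of_set_def)
    qed
  qed (use finL finA in auto)
  also have "\<dots> = measure_pmf.prob (loop_measure \<beta> u S) (\<Union>\<sigma>\<in>permutations_of_set A. L \<sigma>)"
    using finL finA by (simp add: measure_measure_pmf_finite)
  also have "\<dots> \<le> measure_pmf.prob (loop_measure \<beta> u S) {c. fst ` set c = A \<and> cancelled c e}"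
    by (rule measure_pmf.finite_measure_mono, use canc in blast) simp
  finally show ?thesis by (simp add: k_def)
qed

section \<open>Thinning a separated set of edges\<close>

lemma prob_finite_range:
  assumes "finite Z" "\<And>c. c \<in> set_pmf M \<Longrightarrow> g c \<in> Z"
  shows "measure_pmf.prob M {c. P (g c)} = (\<Sum>z\<in>Z. measure_pmf.prob M {c. g c = z} * of_bool (P z))"
proof -
  have "measure_pmf.prob M {c. P (g c)} = measure_pmf.prob (map_pmf g M) {z. P z}"
    by (simp add: vimage_def)
  also have "\<dots> = measure_pmf.prob (map_pmf g M) {z \<in> Z. P z}"
    using assms(2) by (intro measure_prob_cong_0) (auto simp: pmf_eq_0_set_pmf)
  also have "\<dots> = (\<Sum>z\<in>{z \<in> Z. P z}. pmf (map_pmf g M) z)"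
    using assms(1) by (intro measure_measure_pmf_finite) simp
  also have "\<dots> = (\<Sum>z\<in>Z. pmf (map_pmf g M) z * of_bool (P z))"
    using assms(1) by (simp add: sum.inter_filter if_distrib of_bool_def cong: if_cong)
  finally show ?thesis by (simp add: pmf_map vimage_def)
qed

definition touching :: "'v set set \<Rightarrow> 'v set \<Rightarrow> 'v set set" where
  "touching S e = {g \<in> S. g \<inter> e \<noteq> {}}"

text \<open>Links not touching \<open>e\<close> are discarded by \<open>cancelled\<close> anyway.
  This lets cancellation be expressed through restrictions of \<open>c\<close>, to which
  independence applies.\<close>

lemma cancelled_filter:
  assumes "\<And>l. l \<in> set c \<Longrightarrow> fst l \<inter> e \<noteq> {} \<Longrightarrow> fst l \<in> S"
  shows "cancelled (filter (\<lambda>l. fst l \<in> S) c) e \<longleftrightarrow> cancelled c e"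
proof -
  have "filter (\<lambda>l. fst l \<inter> e \<noteq> {}) (filter (\<lambda>l. fst l \<in> S) c) = filter (\<lambda>l. fst l \<inter> e \<noteq> {}) c"
    unfolding filter_filter using assms by (intro filter_cong) auto
  then show ?thesis by (simp add: cancelled_def)
qed

text \<open>Edges of \<open>C\<close> without any link are counted as cancelled as well. This changes nothing in the
  set of usable edges, and makes the bound on the conditional probability hold for every value
  of the set of edges with links.\<close>
lemma prob_uncancelled_le:
  fixes \<beta> u x :: real and S :: "'v set set"
  assumes S: "finite S" and ne: "{} \<notin> S" and \<beta>: "0 < \<beta>" and u: "0 \<le> u" "u \<le> 1"
    and C: "C \<subseteq> S" "\<And>e f. e \<in> C \<Longrightarrow> f \<in> C \<Longrightarrow> e \<noteq> f \<Longrightarrow> touching S e \<inter> touching S f = {}"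
    and x: "0 \<le> x" "x \<le> 1"
      "\<And>e A. e \<in> C \<Longrightarrow> A \<subseteq> touching S e \<Longrightarrow> e \<in> A \<Longrightarrow>
        x \<le> \<beta> * u\<^sup>2 * (\<beta> / (exp \<beta> - 1)) ^ card A / (real (card A) + 1)"
    and F: "\<And>Z Z'. F Z \<Longrightarrow> Z \<subseteq> Z' \<Longrightarrow> F Z'"
  shows "measure_pmf.prob (loop_measure \<beta> u S) {c. F (fst ` set c - {e \<in> C. cancelled c e})}
    \<le> bern_exp (\<lambda>e. (1 - exp (-\<beta>)) * (if e \<in> C then 1 - x else 1)) S (\<lambda>Z. of_bool (F Z))"
proof -
  let ?M = "loop_measure \<beta> u S"
  \<comment> \<open>The usable edges are those in \<open>D c\<close> that carry a link;
    \<open>t\<close> is the dominating parameter for \<open>D c\<close> given the set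
    \<open>A\<close> of edges with links.\<close>
  define D where "D = (\<lambda>c :: ('v set \<times> int) list. S - {e \<in> C. cancelled c e \<or> e \<notin> fst ` set c})"
  define t where "t = (\<lambda>e. if e \<in> C then 1 - x else 1)"
  define a where "a = (\<lambda>A T. measure_pmf.prob ?M {c. fst ` set c = A \<and> D c = T})"
  have supp: "fst ` set c \<subseteq> S" if "c \<in> set_pmf ?M" for c
    using set_loop_measure[OF S that] by fastforce
  have "measure_pmf.prob ?M {c. F (fst ` set c - {e \<in> C. cancelled c e})}
      = measure_pmf.prob ?M {c. (\<lambda>(A, T). F (A \<inter> T)) (fst ` set c, D c)}"
  proof (rule prob_cong_set_pmf)
    fix c assume "c \<in> set_pmf ?M"
    then have "fst ` set c - {e \<in> C. cancelled c e} = fst ` set c \<inter> D c"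
      using supp[of c] by (auto simp: D_def)
    then show "F (fst ` set c - {e \<in> C. cancelled c e}) \<longleftrightarrow> (\<lambda>(A, T). F (A \<inter> T)) (fst ` set c, D c)"
      by simp
  qed
  also have "\<dots> = (\<Sum>z\<in>Pow S \<times> Pow S. measure_pmf.prob ?M {c. (fst ` set c, D c) = z} *
      of_bool ((\<lambda>(A, T). F (A \<inter> T)) z))"
    using S supp by (intro prob_finite_range) (auto simp: D_def)
  also have "\<dots> = (\<Sum>A\<in>Pow S. \<Sum>T\<in>Pow S. a A T * of_bool (F (A \<inter> T)))"
    unfolding sum.cartesian_product a_def by (intro sum.cong) auto
  also have "\<dots> \<le> (\<Sum>A\<in>Pow S. bern_weight (\<lambda>_. 1 - exp (-\<beta>)) S A * bern_exp t S (\<lambda>T. of_bool (F (A \<inter> T))))"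
  proof (rule sum_mono)
    fix A assume "A \<in> Pow S"
    then have A: "A \<subseteq> S" by simp
    have dom: "a A (insert e T) \<le> t e * (a A T + a A (insert e T))" if e: "e \<in> S" and T: "T \<subseteq> S - {e}" for e T
    proof -
      \<comment> \<open>Edges outside \<open>C\<close> are never removed and have
        \<open>t e = 1\<close>; an edge of \<open>C\<close> without links is never in
        \<open>D c\<close>. The last case is the substantial one.\<close>
      consider "e \<notin> C" | "e \<in> C" "e \<notin> A" | "e \<in> C" "e \<in> A" by auto
      then show ?thesis
      proof cases
        case 1
        then show ?thesis by (simp add: t_def a_def)
      next
        case 2
        then have "{c. fst ` set c = A \<and> D c = insert e T} = {}" by (auto simp: D_def)
        then have "a A (insert e T) = 0" by (simp only: a_def measure_empty)
        then show ?thesis using 2 x by (simp add: t_def a_def)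
      next
        case 3
        \<comment> \<open>The links on \<open>S1\<close> decide whether \<open>e\<close> is
          cancelled, those on \<open>S2\<close> the state of every other edge of \<open>C\<close>,
          whose neighbourhood is disjoint from that of \<open>e\<close>.\<close>
        define S1 where "S1 = touching S e"
        define S2 where "S2 = S - S1"
        have S12: "S1 \<union> S2 = S" "S1 \<inter> S2 = {}" "finite S1" "finite S2"
          using S by (auto simp: S1_def S2_def touching_def)
        have eS1: "e \<in> S1" using ne e by (auto simp: S1_def touching_def)
        define f1 where "f1 = filter (\<lambda>l :: 'v set \<times> int. fst l \<in> S1)"
        define f2 where "f2 = filter (\<lambda>l :: 'v set \<times> int. fst l \<in> S2)"
        \<comment> \<open>\<open>D'\<close> applied to the links on \<open>S2\<close> reproduces
          \<open>D c - {e}\<close>.\<close>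
        define D' where "D' = (\<lambda>c. S - {e} - {f \<in> C - {e}. cancelled c f \<or> f \<notin> fst ` set c})"
        define Q where "Q = (\<lambda>c. fst ` set c = A \<inter> S2 \<and> D' c = T)"
        have split: "(fst ` set c = A \<longleftrightarrow> fst ` set (f1 c) = A \<inter> S1 \<and> fst ` set (f2 c) = A \<inter> S2) \<and>
            (cancelled c e \<longleftrightarrow> cancelled (f1 c) e) \<and> D c - {e} = D' (f2 c)" if c: "c \<in> set_pmf ?M" for c
        proof (intro conjI)
          have cS: "fst ` set c \<subseteq> S" using supp[OF c] .
          have "fst ` set (f1 c) = fst ` set c \<inter> S1" "fst ` set (f2 c) = fst ` set c \<inter> S2"
            by (auto simp: f1_def f2_def)
          moreover have "X = A \<longleftrightarrow> X \<inter> S1 = A \<inter> S1 \<and> X \<inter> S2 = A \<inter> S2" if "X \<subseteq> S" for X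
            using that A S12(1) by (metis Int_Un_distrib inf.absorb1)
          ultimately show "fst ` set c = A \<longleftrightarrow> fst ` set (f1 c) = A \<inter> S1 \<and> fst ` set (f2 c) = A \<inter> S2"
            using cS by metis
          show "cancelled c e \<longleftrightarrow> cancelled (f1 c) e"
            unfolding f1_def using cS by (subst cancelled_filter) (auto simp: S1_def touching_def)
          have "(cancelled c f \<longleftrightarrow> cancelled (f2 c) f) \<and> (f \<in> fst ` set c \<longleftrightarrow> f \<in> fst ` set (f2 c))"
            if f: "f \<in> C - {e}" for f
          proof
            have disj: "touching S f \<inter> S1 = {}" using C(2)[of f e] f 3 by (simp add: S1_def)
            then have *: "g \<in> S2" if "g \<in> S" "g \<inter> f \<noteq> {}" for g
              using that by (auto simp: S2_def touching_def)
            show "cancelled c f \<longleftrightarrow> cancelled (f2 c) f"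
              unfolding f2_def using cS * by (subst cancelled_filter) auto
            have "f \<in> S2" using f C(1) ne by (intro *) auto
            then show "f \<in> fst ` set c \<longleftrightarrow> f \<in> fst ` set (f2 c)" by (auto simp: f2_def)
          qed
          then show "D c - {e} = D' (f2 c)" unfolding D_def D'_def by auto
        qed
        have mem: "e \<in> D c \<longleftrightarrow> \<not> cancelled c e" if "fst ` set c = A" for c
          using that 3 e by (auto simp: D_def)
        have split_prob: "measure_pmf.prob ?M {c. P (f1 c) \<and> Q (f2 c)}
            = measure_pmf.prob (loop_measure \<beta> u S1) {c. P c} * measure_pmf.prob (loop_measure \<beta> u S2) {c. Q c}" for P
          using prob_loop_measure_split[OF S12(3,4,2) \<beta> u, of P Q] unfolding S12(1) f1_def f2_def .
        define P1 where "P1 = measure_pmf.prob (loop_measure \<beta> u S1) {c. fst ` set c = A \<inter> S1}"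
        define P1' where "P1' = measure_pmf.prob (loop_measure \<beta> u S1) {c. fst ` set c = A \<inter> S1 \<and> cancelled c e}"
        define P2 where "P2 = measure_pmf.prob (loop_measure \<beta> u S2) {c. Q c}"
        have "a A T = measure_pmf.prob ?M {c. (\<lambda>c. fst ` set c = A \<inter> S1 \<and> cancelled c e) (f1 c) \<and> Q (f2 c)}"
          unfolding a_def
        proof (rule prob_cong_set_pmf)
          fix c assume "c \<in> set_pmf ?M"
          note s = split[OF this]
          have "D c = T \<longleftrightarrow> e \<notin> D c \<and> D c - {e} = T" using T by blast
          then show "fst ` set c = A \<and> D c = T \<longleftrightarrow>
              (\<lambda>c. fst ` set c = A \<inter> S1 \<and> cancelled c e) (f1 c) \<and> Q (f2 c)"
            using s mem[of c] unfolding Q_def by metis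
        qed
        then have aT: "a A T = P1' * P2" unfolding P1'_def P2_def
          using split_prob[of "\<lambda>c. fst ` set c = A \<inter> S1 \<and> cancelled c e"] by (simp only:)
        have "a A T + a A (insert e T) = measure_pmf.prob ?M
            ({c. fst ` set c = A \<and> D c = T} \<union> {c. fst ` set c = A \<and> D c = insert e T})"
          unfolding a_def using T by (subst measure_pmf.finite_measure_Union) auto
        also have "{c. fst ` set c = A \<and> D c = T} \<union> {c. fst ` set c = A \<and> D c = insert e T}
            = {c. fst ` set c = A \<and> D c - {e} = T}"
          using T by auto
        also have "measure_pmf.prob ?M \<dots> = measure_pmf.prob ?M {c. (\<lambda>c. fst ` set c = A \<inter> S1) (f1 c) \<and> Q (f2 c)}"
        proof (rule prob_cong_set_pmf)
          fix c assume "c \<in> set_pmf ?M"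
          note s = split[OF this]
          then show "fst ` set c = A \<and> D c - {e} = T \<longleftrightarrow> (\<lambda>c. fst ` set c = A \<inter> S1) (f1 c) \<and> Q (f2 c)"
            unfolding Q_def by metis
        qed
        finally have sum: "a A T + a A (insert e T) = P1 * P2" unfolding P1_def P2_def
          using split_prob[of "\<lambda>c. fst ` set c = A \<inter> S1"] by (simp only:)
        \<comment> \<open>Given \<open>A\<close>, \<open>e\<close> is missing from
          \<open>D c\<close> exactly if it is cancelled. So \<open>a A T\<close> is at least the
          fraction \<open>x\<close> of the sum, which is the bound \<open>1 - x\<close> for the
          presence of \<open>e\<close>.\<close>
        have "x * P1 \<le> \<beta> * u\<^sup>2 * (\<beta> / (exp \<beta> - 1)) ^ card (A \<inter> S1) / (real (card (A \<inter> S1)) + 1) * P1"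
          using 3 eS1 by (intro mult_right_mono x(3)) (auto simp: S1_def P1_def)
        also have "\<dots> \<le> P1'"
          unfolding P1_def P1'_def
          using 3 eS1 by (intro prob_cancelled_ge S12 \<beta> u) (auto simp: S1_def touching_def)
        finally have "x * P1 * P2 \<le> P1' * P2"
          by (intro mult_right_mono) (simp_all add: P2_def)
        then show ?thesis using sum aT 3(1) by (simp add: t_def algebra_simps)
      qed
    qed
    have "(\<Sum>T\<in>Pow S. a A T * of_bool (F (A \<inter> T))) \<le> (\<Sum>T\<in>Pow S. a A T) * bern_exp t S (\<lambda>T. of_bool (F (A \<inter> T)))"
    proof (rule bern_domination[OF S dom])
      show "0 \<le> t e \<and> t e \<le> 1" for e using x by (simp add: t_def)
      show "mono (\<lambda>T. of_bool (F (A \<inter> T)) :: real)"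
      proof (rule monoI)
        fix T T' :: "'v set set" assume "T \<subseteq> T'"
        then have "F (A \<inter> T')" if "F (A \<inter> T)" using F[OF that, of "A \<inter> T'"] by blast
        then show "of_bool (F (A \<inter> T)) \<le> (of_bool (F (A \<inter> T')) :: real)" by simp
      qed
    qed
    also have "(\<Sum>T\<in>Pow S. a A T) = measure_pmf.prob ?M {c. fst ` set c = A}"
    proof -
      have "measure_pmf.prob ?M {c. fst ` set c = A} = measure_pmf.prob ?M {c. (\<lambda>(B, T). B = A) (fst ` set c, D c)}"
        by simp
      also have "\<dots> = (\<Sum>z\<in>Pow S \<times> Pow S. measure_pmf.prob ?M {c. (fst ` set c, D c) = z} *
          of_bool ((\<lambda>(B, T). B = A) z))"
        using S supp by (intro prob_finite_range) (auto simp: D_def)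
      also have "\<dots> = (\<Sum>B\<in>Pow S. \<Sum>T\<in>Pow S. a B T * of_bool (B = A))"
        unfolding sum.cartesian_product a_def by (intro sum.cong) auto
      also have "\<dots> = (\<Sum>B\<in>Pow S. if B = A then \<Sum>T\<in>Pow S. a B T else 0)"
        by (intro sum.cong) auto
      also have "\<dots> = (\<Sum>T\<in>Pow S. a A T)" using S A by simp
      finally show ?thesis by simp
    qed
    also have "\<dots> = bern_weight (\<lambda>_. 1 - exp (-\<beta>)) S A"
      by (rule prob_loop_measure_support[OF S \<beta> u A])
    finally show "(\<Sum>T\<in>Pow S. a A T * of_bool (F (A \<inter> T)))
        \<le> bern_weight (\<lambda>_. 1 - exp (-\<beta>)) S A * bern_exp t S (\<lambda>T. of_bool (F (A \<inter> T)))" .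
  qed
  also have "\<dots> = bern_exp (\<lambda>_. 1 - exp (-\<beta>)) S (\<lambda>A. bern_exp t S (\<lambda>T. of_bool (F (A \<inter> T))))"
    by (simp add: bern_exp_def)
  also have "\<dots> = bern_exp (\<lambda>e. (1 - exp (-\<beta>)) * t e) S (\<lambda>Z. of_bool (F Z))"
    by (rule bern_exp_inter[OF S])
  finally show ?thesis unfolding t_def .
qed

section \<open>The hard-core mixture\<close>

lemma sum_power_card_Pow:
  fixes x :: "'a::comm_semiring_1"
  assumes "finite S"
  shows "(\<Sum>A\<in>Pow S. x ^ card A) = (1 + x) ^ card S"
  using assms
proof (induction S rule: finite_induct)
  case (insert e S)
  have "x ^ card (insert e A) = x * x ^ card A" if "A \<in> Pow S" for A
    using that insert.hyps finite_subset[of A S] by (subst card_insert_disjoint) auto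
  then have "(\<Sum>A\<in>Pow (insert e S). x ^ card A) = (\<Sum>A\<in>Pow S. x ^ card A + x * x ^ card A)"
    unfolding sum_Pow_insert[OF insert.hyps] by (intro sum.cong) auto
  then show ?case
    using insert by (simp add: sum.distrib sum_distrib_left[symmetric] algebra_simps)
qed simp

lemma bern_weight_cong:
  "Z \<subseteq> S \<Longrightarrow> (\<And>e. e \<in> S \<Longrightarrow> p e = p' e) \<Longrightarrow> bern_weight p S Z = bern_weight p' S Z"
  unfolding bern_weight_def by (intro arg_cong2[of _ _ _ _ "(*)"] prod.cong) auto

lemma bern_weight_remove:
  assumes "finite S" "e \<in> S" "Z \<subseteq> S"
  shows "bern_weight p S Z = (if e \<in> Z then p e else 1 - p e) * bern_weight p (S - {e}) (Z - {e})"
proof (cases "e \<in> Z")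
  case True
  then have "insert e (S - {e}) = S" "insert e (Z - {e}) = Z" "Z - {e} \<subseteq> S - {e}" using assms by auto
  then show ?thesis using bern_weight_insert_in[of "S - {e}" e "Z - {e}" p] assms True by simp
next
  case False
  then have "insert e (S - {e}) = S" "Z - {e} = Z" "Z \<subseteq> S - {e}" using assms by auto
  then show ?thesis using bern_weight_insert_out[of "S - {e}" e "Z" p] assms False by simp
qed

text \<open>The independent sets of \<open>R\<close>, on which the hard-core measure lives; the
  condition \<open>e \<noteq> f\<close> admits a reflexive \<open>R\<close>.\<close>

definition separated :: "('e \<Rightarrow> 'e \<Rightarrow> bool) \<Rightarrow> 'e set \<Rightarrow> 'e set set" where
  "separated R S = {C. C \<subseteq> S \<and> (\<forall>e\<in>C. \<forall>f\<in>C. e \<noteq> f \<longrightarrow> \<not> R e f)}"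

text \<open>Averaging over \<open>C\<close> with the hard-core weights \<open>\<lambda> ^ card C\<close>, every \<open>e\<close> belongs to \<open>C\<close> with
  conditional probability at least \<open>\<delta>\<close> given the states of all other elements. The bound
  \<open>q * x \<le> 1 - q\<close> ensures that putting an element into \<open>C\<close> at most doubles the likelihood of
  any configuration.\<close>
lemma separated_domination:
  fixes q x p \<delta> \<kappa> :: real and n :: nat
  assumes S: "finite S" and R: "\<And>e. e \<in> S \<Longrightarrow> R e e" "\<And>e f. R e f \<Longrightarrow> R f e"
    and n: "\<And>e. e \<in> S \<Longrightarrow> card {f \<in> S. R e f} \<le> n"
    and q: "0 \<le> q" "q \<le> 1" and x: "0 \<le> x" "x \<le> 1" "q * x \<le> 1 - q"
    and \<kappa>: "0 < \<kappa>" "\<delta> * (1 + 2 * \<kappa>) ^ n \<le> \<kappa>" "0 \<le> \<delta>"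
    and p: "q * (1 - x * \<delta>) \<le> p" "0 \<le> p" "p \<le> 1"
    and f: "mono f"
    and y: "\<And>C. C \<in> separated R S \<Longrightarrow> y \<le> bern_exp (\<lambda>e. q * (if e \<in> C then 1 - x else 1)) S f"
  shows "y \<le> bern_exp (\<lambda>_. p) S f"
proof -
  define pC where "pC = (\<lambda>(C :: 'a set) e. q * (if e \<in> C then 1 - x else 1))"
  have pC: "0 \<le> pC C e" "pC C e \<le> 1" for C e
    using q x mult_le_one[of q "1 - x"] by (auto simp: pC_def)
  let ?Sep = "separated R S"
  have finSep: "finite ?Sep" using S by (rule rev_finite_subset[OF finite_Pow_iff[THEN iffD2]]) (auto simp: separated_def)
  have finC: "finite C" if "C \<in> ?Sep" for C using that S finite_subset by (auto simp: separated_def)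
  \<comment> \<open>The unnormalised law of the open set when \<open>C\<close> is chosen with weight
    \<open>\<kappa> ^ card C\<close>.\<close>
  define a where "a = (\<lambda>Z. \<Sum>C\<in>?Sep. \<kappa> ^ card C * bern_weight (pC C) S Z)"
  have dom: "a (insert e Z) \<le> p * (a Z + a (insert e Z))" if e: "e \<in> S" and Z: "Z \<subseteq> S - {e}" for e Z
  proof -
    define b where "b = (\<lambda>C. bern_weight (pC C) (S - {e}) Z)"
    have b_nonneg: "0 \<le> b C" for C unfolding b_def using Z pC by (intro bern_weight_nonneg) auto
    have S_e: "insert e (S - {e}) = S" "finite (S - {e})" using e S by auto
    have w_in: "bern_weight (pC C) S (insert e Z) = pC C e * b C" for C
      using bern_weight_insert_in[of "S - {e}" e Z "pC C"] S_e Z by (simp add: b_def)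
    have w_out: "bern_weight (pC C) S Z = (1 - pC C e) * b C" for C
      using bern_weight_insert_out[of "S - {e}" e Z "pC C"] S_e Z by (simp add: b_def)
    \<comment> \<open>\<open>H\<close> is the total weight of the state \<open>Z\<close> off
      \<open>e\<close>, and \<open>H1\<close> its part with \<open>e\<close> in \<open>C\<close>. By
      \<open>in_H\<close> it suffices that \<open>\<delta> * H \<le> H1\<close>.\<close>
    define H where "H = (\<Sum>C\<in>?Sep. \<kappa> ^ card C * b C)"
    define H1 where "H1 = (\<Sum>C\<in>{C \<in> ?Sep. e \<in> C}. \<kappa> ^ card C * b C)"
    have sum_H: "a Z + a (insert e Z) = H"
      unfolding a_def H_def w_in w_out sum.distrib[symmetric] by (intro sum.cong) (auto simp: algebra_simps)
    have in_H: "a (insert e Z) = q * H - q * x * H1"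
    proof -
      have "a (insert e Z) = (\<Sum>C\<in>?Sep. q * (\<kappa> ^ card C * b C) - q * x * (if e \<in> C then \<kappa> ^ card C * b C else 0))"
        unfolding a_def w_in by (intro sum.cong) (auto simp: pC_def algebra_simps)
      also have "\<dots> = q * H - q * x * (\<Sum>C\<in>?Sep. if e \<in> C then \<kappa> ^ card C * b C else 0)"
        by (simp add: sum_subtractf sum_distrib_left[symmetric] H_def)
      also have "(\<Sum>C\<in>?Sep. if e \<in> C then \<kappa> ^ card C * b C else 0) = H1"
        unfolding H1_def using finSep by (simp add: sum.inter_filter)
      finally show ?thesis .
    qed
    define M where "M = {f \<in> S. R e f}"
    have eM: "e \<in> M" using e R by (simp add: M_def)
    have finM: "finite M" using S by (simp add: M_def)
    \<comment> \<open>Sets in \<open>far\<close> leave room for \<open>e\<close>: adding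
      \<open>e\<close> is a bijection onto the separated sets containing \<open>e\<close> and costs
      one factor \<open>\<kappa>\<close>, as \<open>b\<close> ignores \<open>e\<close>.\<close>
    define far where "far = {C \<in> ?Sep. C \<inter> M = {}}"
    define G where "G = (\<Sum>C\<in>far. \<kappa> ^ card C * b C)"
    have fin_far: "finite far" using finSep by (simp add: far_def)
    have G_nonneg: "0 \<le> G" unfolding G_def using b_nonneg \<kappa> by (intro sum_nonneg) auto
    have H1_eq: "H1 = \<kappa> * G"
    proof -
      have "H1 = (\<Sum>C\<in>far. \<kappa> ^ card (insert e C) * b (insert e C))"
        unfolding H1_def
      proof (rule sum.reindex_bij_witness[of _ "insert e" "\<lambda>C. C - {e}"])
        fix C assume "C \<in> {C \<in> ?Sep. e \<in> C}"
        then show "C - {e} \<in> far" using R by (auto simp: far_def separated_def M_def)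
      next
        fix C assume "C \<in> far"
        then show "insert e C \<in> {C \<in> ?Sep. e \<in> C}" "insert e C - {e} = C"
          using e R eM by (auto simp: far_def separated_def M_def)
      qed (auto simp: insert_absorb)
      also have "\<dots> = (\<Sum>C\<in>far. \<kappa> * (\<kappa> ^ card C * b C))"
      proof (rule sum.cong[OF refl])
        fix C assume C: "C \<in> far"
        then have "e \<notin> C" using eM by (auto simp: far_def)
        moreover have "b (insert e C) = b C"
          unfolding b_def using Z by (intro bern_weight_cong) (auto simp: pC_def)
        moreover have "finite C" using C finC by (auto simp: far_def)
        ultimately show "\<kappa> ^ card (insert e C) * b (insert e C) = \<kappa> * (\<kappa> ^ card C * b C)" by simp
      qed
      finally show ?thesis by (simp add: G_def sum_distrib_left)
    qed
    \<comment> \<open>Putting \<open>g\<close> into \<open>C\<close> replaces \<open>q\<close> by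
      \<open>q * (1 - x)\<close> if \<open>g\<close> is open, and \<open>1 - q\<close> by
      \<open>1 - q + q * x\<close> if it is closed; the latter is at most \<open>2 * (1 - q)\<close>
      by the bound on \<open>q * x\<close>.\<close>
    have b_insert: "b (insert g C) \<le> 2 * b C" for g C
    proof (cases "g \<in> S - {e} \<and> g \<notin> C")
      case True
      define b' where "b' = bern_weight (pC C) (S - {e} - {g}) (Z - {g})"
      have b': "0 \<le> b'" unfolding b'_def using Z pC by (intro bern_weight_nonneg) auto
      have "bern_weight (pC (insert g C)) (S - {e} - {g}) (Z - {g}) = b'"
        unfolding b'_def using Z by (intro bern_weight_cong) (auto simp: pC_def)
      then have eq: "b (insert g C) = (if g \<in> Z then pC (insert g C) g else 1 - pC (insert g C) g) * b'"
        "b C = (if g \<in> Z then pC C g else 1 - pC C g) * b'"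
        unfolding b_def b'_def using True S Z by (simp_all add: bern_weight_remove[of "S - {e}" g])
      have "(if g \<in> Z then pC (insert g C) g else 1 - pC (insert g C) g)
          \<le> 2 * (if g \<in> Z then pC C g else 1 - pC C g)"
        using True q x by (simp add: pC_def algebra_simps)
      then show ?thesis unfolding eq mult.assoc[symmetric] using b' by (rule mult_right_mono)
    next
      case False
      then have "b (insert g C) = b C"
        unfolding b_def using Z by (intro bern_weight_cong) (auto simp: pC_def)
      then show ?thesis using b_nonneg[of C] by simp
    qed
    have b_Un: "b (C1 \<union> C2) \<le> 2 ^ card C1 * b C2" if "finite C1" for C1 C2
      using that
    proof (induction C1 rule: finite_induct)
      case (insert g C1)
      have "b (insert g C1 \<union> C2) \<le> 2 * b (C1 \<union> C2)" using b_insert by simp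
      also have "\<dots> \<le> 2 * (2 ^ card C1 * b C2)" using insert.IH by simp
      finally show ?case using insert.hyps by simp
    qed simp
    \<comment> \<open>Erase from each \<open>C\<close> its part in \<open>M\<close>. The rest lies
      in \<open>far\<close>, each erased element costs a factor \<open>2 * \<kappa>\<close>, and
      allowing every subset of \<open>M\<close> as erased part gives a power of
      \<open>1 + 2 * \<kappa>\<close>.\<close>
    have "H \<le> (\<Sum>C\<in>?Sep. (2 * \<kappa>) ^ card (C \<inter> M) * (\<kappa> ^ card (C - M) * b (C - M)))"
      unfolding H_def
    proof (rule sum_mono)
      fix C assume C: "C \<in> ?Sep"
      have "card C = card (C \<inter> M) + card (C - M)"
        using card_Un_disjoint[of "C \<inter> M" "C - M"] finC[OF C] by (simp add: Int_Diff_disjoint Un_Diff_Int Un_commute)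
      moreover have "b C \<le> 2 ^ card (C \<inter> M) * b (C - M)"
        using b_Un[of "C \<inter> M" "C - M"] finC[OF C] by (simp add: Un_Diff_Int Un_commute)
      ultimately show "\<kappa> ^ card C * b C \<le> (2 * \<kappa>) ^ card (C \<inter> M) * (\<kappa> ^ card (C - M) * b (C - M))"
        using \<kappa>(1) by (simp add: power_add power_mult_distrib algebra_simps)
    qed
    also have "\<dots> = (\<Sum>(C1, C2)\<in>(\<lambda>C. (C \<inter> M, C - M)) ` ?Sep. (2 * \<kappa>) ^ card C1 * (\<kappa> ^ card C2 * b C2))"
      by (subst sum.reindex) (auto simp: inj_on_def)
    also have "\<dots> \<le> (\<Sum>(C1, C2)\<in>Pow M \<times> far. (2 * \<kappa>) ^ card C1 * (\<kappa> ^ card C2 * b C2))"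
      using finM fin_far b_nonneg \<kappa>(1)
      by (intro sum_mono2) (auto simp: far_def separated_def)
    also have "\<dots> = (\<Sum>C1\<in>Pow M. (2 * \<kappa>) ^ card C1) * G"
      by (simp add: G_def sum_product sum.cartesian_product)
    also have "\<dots> = (1 + 2 * \<kappa>) ^ card M * G" by (simp only: sum_power_card_Pow[OF finM])
    also have "\<dots> \<le> (1 + 2 * \<kappa>) ^ n * G"
      using n[OF e] \<kappa>(1) G_nonneg by (intro mult_right_mono power_increasing) (auto simp: M_def)
    finally have "\<delta> * H \<le> \<delta> * ((1 + 2 * \<kappa>) ^ n * G)" using \<kappa>(3) by (rule mult_left_mono)
    also have "\<dots> \<le> \<kappa> * G" using mult_right_mono[OF \<kappa>(2) G_nonneg] by (simp add: mult.assoc)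
    finally have "\<delta> * H \<le> H1" by (simp add: H1_eq)
    then have "q * x * (\<delta> * H) \<le> q * x * H1" using q x by (intro mult_left_mono) auto
    then have "a (insert e Z) \<le> q * (1 - x * \<delta>) * H" unfolding in_H by (simp add: algebra_simps)
    also have "\<dots> \<le> p * H"
      using p(1) b_nonneg \<kappa>(1) by (intro mult_right_mono) (auto simp: H_def intro!: sum_nonneg)
    finally show ?thesis by (simp add: sum_H)
  qed
  \<comment> \<open>\<open>W\<close> is the partition function. The bound on \<open>y\<close> holds
    for every \<open>C\<close>, hence for the mixture, to which \<open>bern_domination\<close>
    applies.\<close>
  define W where "W = (\<Sum>C\<in>?Sep. \<kappa> ^ card C)"
  have "{} \<in> ?Sep" by (simp add: separated_def)
  then have "0 < W" unfolding W_def using \<kappa>(1) finSep by (intro sum_pos2[of _ "{}"]) auto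
  have "(\<Sum>Z\<in>Pow S. a Z) = (\<Sum>C\<in>?Sep. \<Sum>Z\<in>Pow S. \<kappa> ^ card C * bern_weight (pC C) S Z)"
    unfolding a_def by (rule sum.swap)
  also have "\<dots> = (\<Sum>C\<in>?Sep. \<kappa> ^ card C * bern_exp (pC C) S (\<lambda>_. 1))"
    by (simp add: bern_exp_def sum_distrib_left)
  finally have sum_a: "(\<Sum>Z\<in>Pow S. a Z) = W" using S by (simp add: W_def)
  have "W * y \<le> (\<Sum>C\<in>?Sep. \<kappa> ^ card C * bern_exp (pC C) S f)"
    unfolding W_def sum_distrib_right using y \<kappa>(1) by (intro sum_mono mult_left_mono) (auto simp: pC_def)
  also have "\<dots> = (\<Sum>C\<in>?Sep. \<Sum>Z\<in>Pow S. \<kappa> ^ card C * bern_weight (pC C) S Z * f Z)"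
    by (simp add: bern_exp_def sum_distrib_left mult.assoc)
  also have "\<dots> = (\<Sum>Z\<in>Pow S. a Z * f Z)"
    unfolding a_def sum_distrib_right by (rule sum.swap)
  also have "\<dots> \<le> (\<Sum>Z\<in>Pow S. a Z) * bern_exp (\<lambda>_. p) S f"
    using p by (intro bern_domination[OF S dom _ f]) auto
  finally show ?thesis using \<open>0 < W\<close> by (simp add: sum_a)
qed

section \<open>Infinite volume\<close>

lemma prob_space_perc: "prob_space (perc_measure E p)"
  unfolding perc_measure_def by (intro prob_space_PiM measure_pmf.prob_space_axioms)

lemma sets_cylinder:
  assumes "finite J" "J \<subseteq> gedges E"
  shows "{\<omega> \<in> space (perc_measure E p). \<forall>e\<in>J. \<omega> e = X e} \<in> sets (perc_measure E p)"
proof (rule sets.sets_Collect_finite_All[OF _ assms(1)])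
  fix e assume "e \<in> J"
  then have "(\<lambda>\<omega>. \<omega> e) \<in> perc_measure E p \<rightarrow>\<^sub>M measure_pmf (bernoulli_pmf p)"
    unfolding perc_measure_def using assms by (intro measurable_component_singleton) auto
  from measurable_sets[OF this, of "{X e}"]
  show "{\<omega> \<in> space (perc_measure E p). \<omega> e = X e} \<in> sets (perc_measure E p)"
    by (simp add: vimage_def Int_def conj_commute)
qed

lemma measure_cylinder:
  assumes "finite J" "J \<subseteq> gedges E"
  shows "measure (perc_measure E p) {\<omega> \<in> space (perc_measure E p). \<forall>e\<in>J. \<omega> e = X e}
    = (\<Prod>e\<in>J. pmf (bernoulli_pmf p) (X e))"
proof -
  interpret product_prob_space "\<lambda>_. measure_pmf (bernoulli_pmf p)" "gedges E"
    by unfold_locales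
  have "emeasure (perc_measure E p) {\<omega> \<in> space (perc_measure E p). \<forall>e\<in>J. \<omega> e \<in> {X e}}
      = (\<Prod>e\<in>J. emeasure (measure_pmf (bernoulli_pmf p)) {X e})"
    unfolding perc_measure_def using assms by (intro emeasure_PiM_Collect) auto
  also have "\<dots> = ennreal (\<Prod>e\<in>J. pmf (bernoulli_pmf p) (X e))"
    by (simp add: emeasure_pmf_single prod_ennreal)
  finally show ?thesis by (simp add: measure_def prod_nonneg)
qed

text \<open>The left side is the measure of a disjoint union of cylinders over \<open>S\<close>, all
  contained in \<open>D\<close>.\<close>

lemma bern_exp_le_perc:
  assumes S: "finite S" "S \<subseteq> gedges E" and p: "0 \<le> p" "p \<le> 1"
    and D: "D \<in> sets (perc_measure E p)"
    and F: "\<And>\<omega>. \<omega> \<in> space (perc_measure E p) \<Longrightarrow> F {e \<in> S. \<omega> e} \<Longrightarrow> \<omega> \<in> D"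
  shows "bern_exp (\<lambda>_. p) S (\<lambda>Z. of_bool (F Z)) \<le> measure (perc_measure E p) D"
proof -
  interpret prob_space "perc_measure E p" by (rule prob_space_perc)
  define cyl where "cyl = (\<lambda>Z. {\<omega> \<in> space (perc_measure E p). \<forall>e\<in>S. \<omega> e = (e \<in> Z)})"
  define Fs where "Fs = {Z \<in> Pow S. F Z}"
  have "finite Fs" using S by (simp add: Fs_def)
  have weight: "bern_weight (\<lambda>_. p) S Z = measure (perc_measure E p) (cyl Z)" if "Z \<in> Pow S" for Z
  proof -
    have "measure (perc_measure E p) (cyl Z) = (\<Prod>e\<in>S. if e \<in> Z then p else 1 - p)"
      unfolding cyl_def measure_cylinder[OF S] using p by (intro prod.cong) auto
    also have "\<dots> = (\<Prod>e\<in>S \<inter> {e. e \<in> Z}. p) * (\<Prod>e\<in>S \<inter> - {e. e \<in> Z}. 1 - p)"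
      using S(1) by (rule prod.If_cases)
    also have "\<dots> = bern_weight (\<lambda>_. p) S Z"
      unfolding bern_weight_def using that by (intro arg_cong2[of _ _ _ _ "(*)"] prod.cong) auto
    finally show ?thesis ..
  qed
  have "bern_exp (\<lambda>_. p) S (\<lambda>Z. of_bool (F Z)) = (\<Sum>Z\<in>Pow S. if F Z then bern_weight (\<lambda>_. p) S Z else 0)"
    unfolding bern_exp_def by (intro sum.cong) auto
  also have "\<dots> = (\<Sum>Z\<in>Fs. bern_weight (\<lambda>_. p) S Z)"
    unfolding Fs_def using S by (intro sum.inter_filter[symmetric]) simp
  also have "\<dots> = (\<Sum>Z\<in>Fs. measure (perc_measure E p) (cyl Z))"
    using weight by (intro sum.cong) (auto simp: Fs_def)
  also have "\<dots> = measure (perc_measure E p) (\<Union>Z\<in>Fs. cyl Z)"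
  proof (rule finite_measure_finite_Union[symmetric])
    show "cyl ` Fs \<subseteq> sets (perc_measure E p)"
      using sets_cylinder[OF S] by (auto simp: cyl_def)
    show "disjoint_family_on cyl Fs"
      unfolding disjoint_family_on_def cyl_def Fs_def by blast
  qed fact
  also have "\<dots> \<le> measure (perc_measure E p) D"
  proof (rule finite_measure_mono[OF _ D])
    show "(\<Union>Z\<in>Fs. cyl Z) \<subseteq> D"
    proof safe
      fix Z \<omega> assume Z: "Z \<in> Fs" and \<omega>: "\<omega> \<in> cyl Z"
      then have "{e \<in> S. \<omega> e} = Z" by (auto simp: Fs_def cyl_def)
      then show "\<omega> \<in> D" using Z \<omega> by (intro F) (auto simp: Fs_def cyl_def)
    qed
  qed
  finally show ?thesis .
qed

section \<open>Open clusters reaching far\<close>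

lemma gdist_relpowp:
  assumes "E\<^sup>*\<^sup>* v w"
  shows "(E ^^ gdist E v w) v w"
proof -
  obtain n where "(E ^^ n) v w" using assms by (auto simp: rtranclp_power)
  then have "\<exists>n p. p 0 = v \<and> p n = w \<and> (\<forall>i<n. E (p i) (p (Suc i)))"
    by (auto simp: relpowp_fun_conv)
  then have "\<exists>p. p 0 = v \<and> p (gdist E v w) = w \<and> (\<forall>i<gdist E v w. E (p i) (p (Suc i)))"
    unfolding gdist_def by (rule LeastI_ex)
  then show ?thesis by (simp add: relpowp_fun_conv)
qed

lemma finite_relpowp:
  fixes E :: "'v \<Rightarrow> 'v \<Rightarrow> bool"
  assumes "\<And>x. finite {y. E x y}"
  shows "finite {w. (E ^^ n) v w}"
proof (induction n)
  case (Suc n)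
  have "{w. (E ^^ Suc n) v w} = (\<Union>y\<in>{w. (E ^^ n) v w}. {w. E y w})" by auto
  then show ?case using Suc assms by simp
qed simp

text \<open>An event of percolation on the whole graph that bounds the loop events of all finite
  volumes at once.\<close>

definition far_cluster :: "('v \<Rightarrow> 'v \<Rightarrow> bool) \<Rightarrow> real \<Rightarrow> 'v \<Rightarrow> nat \<Rightarrow> ('v set \<Rightarrow> bool) set" where
  "far_cluster E p v R = {\<omega> \<in> space (perc_measure E p). \<exists>w. R \<le> gdist E v w \<and> w \<in> open_cluster E \<omega> v}"

text \<open>Open paths are treated by induction on their length; countability of the vertex set
  keeps the unions over intermediate and final vertices countable.\<close>

lemma sets_far_cluster:
  fixes E :: "'v \<Rightarrow> 'v \<Rightarrow> bool"
  assumes "countable (UNIV :: 'v set)"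
  shows "far_cluster E p v R \<in> sets (perc_measure E p)"
proof -
  let ?M = "perc_measure E p"
  have step: "{\<omega> \<in> space ?M. E x y \<and> \<omega> {x, y}} \<in> sets ?M" for x y
  proof (cases "E x y")
    case True
    then show ?thesis
      using sets_cylinder[of "{{x, y}}" E p "\<lambda>_. True"] by (auto simp: gedges_def)
  qed simp
  have pow: "{\<omega> \<in> space ?M. ((\<lambda>x y. E x y \<and> \<omega> {x, y}) ^^ n) v w} \<in> sets ?M" for n w
  proof (induction n arbitrary: w)
    case (Suc n)
    have "{\<omega> \<in> space ?M. \<exists>y\<in>UNIV. ((\<lambda>x y. E x y \<and> \<omega> {x, y}) ^^ n) v y \<and> (E y w \<and> \<omega> {y, w})} \<in> sets ?M"
      by (rule sets.sets_Collect_countable_Ex'[OF _ assms], rule sets.sets_Collect_conj[OF step Suc])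
    then show ?case by (simp add: relcompp_apply)
  qed simp
  have "{\<omega> \<in> space ?M. \<exists>w\<in>UNIV. R \<le> gdist E v w \<and> (\<exists>n. ((\<lambda>x y. E x y \<and> \<omega> {x, y}) ^^ n) v w)} \<in> sets ?M"
    by (intro sets.sets_Collect_countable_Ex'[OF _ assms] sets.sets_Collect_conj sets.sets_Collect_countable_Ex pow
        sets.sets_Collect_const)
  then show ?thesis by (simp add: far_cluster_def open_cluster_def rtranclp_power)
qed

text \<open>Continuity from above. Distances are bounded on a finite cluster; conversely balls are
  finite by local finiteness, so an infinite cluster leaves each of them.\<close>

lemma far_cluster_tendsto:
  fixes E :: "'v \<Rightarrow> 'v \<Rightarrow> bool"
  assumes cnt: "countable (UNIV :: 'v set)" and conn: "\<And>x y. E\<^sup>*\<^sup>* x y" and fin: "\<And>x. finite {y. E x y}"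
  shows "(\<lambda>R. measure (perc_measure E p) (far_cluster E p v R)) \<longlonglongrightarrow> perc_theta E v p"
proof -
  interpret prob_space "perc_measure E p" by (rule prob_space_perc)
  have "(\<Inter>R. far_cluster E p v R) = {\<omega> \<in> space (perc_measure E p). infinite (open_cluster E \<omega> v)}"
  proof (intro set_eqI iffI)
    fix \<omega> assume *: "\<omega> \<in> (\<Inter>R. far_cluster E p v R)"
    have "infinite (open_cluster E \<omega> v)"
    proof
      assume fin: "finite (open_cluster E \<omega> v)"
      obtain w where w: "Suc (Max (gdist E v ` open_cluster E \<omega> v)) \<le> gdist E v w" "w \<in> open_cluster E \<omega> v"
        using * by (auto simp: far_cluster_def)
      then have "gdist E v w \<le> Max (gdist E v ` open_cluster E \<omega> v)" using fin by (intro Max_ge) auto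
      with w show False by simp
    qed
    with * show "\<omega> \<in> {\<omega> \<in> space (perc_measure E p). infinite (open_cluster E \<omega> v)}"
      by (auto simp: far_cluster_def)
  next
    fix \<omega> assume *: "\<omega> \<in> {\<omega> \<in> space (perc_measure E p). infinite (open_cluster E \<omega> v)}"
    have "\<exists>w. R \<le> gdist E v w \<and> w \<in> open_cluster E \<omega> v" for R
    proof (rule ccontr)
      assume "\<not> (\<exists>w. R \<le> gdist E v w \<and> w \<in> open_cluster E \<omega> v)"
      then have "open_cluster E \<omega> v \<subseteq> (\<Union>n<R. {w. (E ^^ n) v w})"
        using gdist_relpowp[OF conn] by (force simp: not_le)
      then have "finite (open_cluster E \<omega> v)"
        by (rule finite_subset) (use finite_relpowp[OF fin] in auto)
      with * show False by simp
    qed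
    with * show "\<omega> \<in> (\<Inter>R. far_cluster E p v R)" by (auto simp: far_cluster_def)
  qed
  then have "perc_theta E v p = measure (perc_measure E p) (\<Inter>R. far_cluster E p v R)"
    by (simp add: perc_theta_def)
  moreover have "decseq (far_cluster E p v)"
    unfolding decseq_def far_cluster_def using order_trans by blast
  ultimately show ?thesis
    using sets_far_cluster[OF cnt] by (simp add: finite_Lim_measure_decseq image_subset_iff)
qed

text \<open>Almost surely the finitely many edges at \<open>v\<close> are all closed. This shows
  that the set in \<open>p_crit\<close> is nonempty, so that its supremum is meaningful.\<close>

lemma perc_theta_zero:
  assumes fin: "finite {y. E v y}"
  shows "perc_theta E v 0 = 0"
proof -
  interpret prob_space "perc_measure E 0" by (rule prob_space_perc)
  let ?M = "perc_measure E 0"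
  define J where "J = (\<lambda>y. {v, y}) ` {y. E v y}"
  have J: "finite J" "J \<subseteq> gedges E" using fin by (auto simp: J_def gedges_def)
  define A where "A = {\<omega> \<in> space ?M. \<forall>e\<in>J. \<omega> e = False}"
  have A: "A \<in> sets ?M" unfolding A_def by (rule sets_cylinder[OF J])
  have "prob A = 1" unfolding A_def measure_cylinder[OF J] by simp
  then have "prob (space ?M - A) = 0" using prob_compl[OF A] by simp
  moreover have "{\<omega> \<in> space ?M. infinite (open_cluster E \<omega> v)} \<subseteq> space ?M - A"
  proof safe
    fix \<omega> assume "infinite (open_cluster E \<omega> v)" "\<omega> \<in> A"
    then have no: "\<not> (E v y \<and> \<omega> {v, y})" for y by (auto simp: A_def J_def)
    have "open_cluster E \<omega> v \<subseteq> {v}"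
      unfolding open_cluster_def using no by (auto elim: converse_rtranclpE)
    then show False using \<open>infinite (open_cluster E \<omega> v)\<close> finite_subset by blast
  qed
  ultimately have "prob {\<omega> \<in> space ?M. infinite (open_cluster E \<omega> v)} \<le> 0"
    using finite_measure_mono[of _ "space ?M - A"] A by (metis sets.compl_sets)
  then show ?thesis unfolding perc_theta_def using measure_nonneg by (metis order_antisym)
qed

lemma p_crit_less:
  assumes "finite {y. E v y}" "x < p_crit E v"
  obtains p where "0 \<le> p" "p \<le> 1" "x < p" "perc_theta E v p = 0"
proof -
  let ?P = "{p \<in> {0..1}. perc_theta E v p = 0}"
  have "0 \<in> ?P" using perc_theta_zero[of E v] assms(1) by simp
  moreover have "bdd_above ?P" by (rule bdd_aboveI[of _ 1]) auto
  ultimately have "x < Sup ?P \<longleftrightarrow> (\<exists>p\<in>?P. x < p)"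
    by (intro less_cSup_iff) blast+
  then obtain p where "p \<in> ?P" "x < p"
    using assms(2) unfolding p_crit_def by blast
  then show ?thesis using that by auto
qed

section \<open>Absence of loop percolation\<close>

text \<open>Edges touching \<open>{x, y}\<close> lie in the stars of \<open>x\<close> and
  \<open>y\<close>, of at most \<open>K\<close> edges each, and \<open>e\<close> lies in both; hence
  the \<open>- 1\<close>.\<close>

lemma card_touching_le:
  assumes sym: "\<And>x y. E x y \<Longrightarrow> E y x"
    and deg: "\<And>x. finite {y. E x y} \<and> card {y. E x y} \<le> K"
    and S: "S \<subseteq> gedges E" and e: "e \<in> gedges E"
  shows "finite (touching S e)" "card (touching S e) \<le> 2 * K - 1"
proof -
  obtain x y where xy: "e = {x, y}" "E x y" using e by (auto simp: gedges_def)
  define star where "star = (\<lambda>x. (\<lambda>y. {x, y}) ` {y. E x y})"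
  have star: "finite (star z)" "card (star z) \<le> K" for z
    using deg[of z] card_image_le[of "{y. E z y}" "\<lambda>y. {z, y}"] by (auto simp: star_def)
  have sub: "touching S e \<subseteq> star x \<union> star y"
  proof
    fix g assume g: "g \<in> touching S e"
    then have "g \<in> gedges E" using S by (auto simp: touching_def)
    then obtain a b where "g = {a, b}" "E a b" by (auto simp: gedges_def)
    then show "g \<in> star x \<union> star y"
      using g xy sym[of a b] by (auto simp: touching_def star_def image_iff insert_commute)
  qed
  have "e \<in> star x \<inter> star y"
    using xy sym by (auto simp: star_def image_iff insert_commute)
  then have "1 \<le> card (star x \<inter> star y)"
    using star by (metis One_nat_def Suc_leI card_gt_0_iff emptyE finite_Int)
  then have "card (star x \<union> star y) \<le> 2 * K - 1"
    using card_Un_Int[of "star x" "star y"] star[of x] star[of y] by simp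
  then show "card (touching S e) \<le> 2 * K - 1"
    using card_mono[OF _ sub] star by simp
  show "finite (touching S e)" using sub star by (meson finite_Un finite_subset)
qed

text \<open>If \<open>g\<close> touches both \<open>e\<close> and \<open>f\<close>, then
  \<open>f\<close> is reached from \<open>e\<close> in two touching steps, each with at most
  \<open>2 * K - 1\<close> choices.\<close>

lemma card_touching_twice_le:
  assumes sym: "\<And>x y. E x y \<Longrightarrow> E y x"
    and deg: "\<And>x. finite {y. E x y} \<and> card {y. E x y} \<le> K"
    and S: "S \<subseteq> gedges E" and e: "e \<in> gedges E"
  shows "card {f \<in> S. touching S e \<inter> touching S f \<noteq> {}} \<le> (2 * K - 1)\<^sup>2"
proof -
  note t = card_touching_le[of E K S, OF sym deg S]
  have sub: "{f \<in> S. touching S e \<inter> touching S f \<noteq> {}} \<subseteq> (\<Union>g\<in>touching S e. touching S g)"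
    by (auto simp: touching_def)
  have tS: "g \<in> gedges E" if "g \<in> touching S e" for g using that S by (auto simp: touching_def)
  have "card {f \<in> S. touching S e \<inter> touching S f \<noteq> {}} \<le> card (\<Union>g\<in>touching S e. touching S g)"
    using t tS e by (intro card_mono sub) auto
  also have "\<dots> \<le> (\<Sum>g\<in>touching S e. card (touching S g))"
    using t e by (intro card_UN_le)
  also have "\<dots> \<le> card (touching S e) * (2 * K - 1)"
    using sum_bounded_above[of "touching S e" "\<lambda>g. card (touching S g)" "2 * K - 1"] t tS by simp
  also have "\<dots> \<le> (2 * K - 1) * (2 * K - 1)" using t e by (intro mult_right_mono) auto
  finally show ?thesis by (simp add: power2_eq_square)
qed

text \<open>With degrees at most one, \<open>v\<close> and its neighbours would form a whole
  component. The bound enters the numerical estimates below.\<close>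

lemma infinite_connected_max_degree_ge_2:
  fixes E :: "'v \<Rightarrow> 'v \<Rightarrow> bool"
  assumes sym: "\<And>x y. E x y \<Longrightarrow> E y x" and inf: "infinite (UNIV :: 'v set)"
    and conn: "\<And>x y. E\<^sup>*\<^sup>* x y"
    and deg: "\<And>x. finite {y. E x y} \<and> card {y. E x y} \<le> K"
  shows "2 \<le> K"
proof (rule ccontr)
  assume "\<not> 2 \<le> K"
  then have K: "K \<le> 1" by simp
  fix v :: 'v
  define T where "T = insert v {y. E v y}"
  have uniq: "y = z" if "E x y" "E x z" for x y z
    using deg[of x] K that card_le_Suc0_iff_eq[of "{y. E x y}"] by auto
  have "w \<in> T" for w
    using conn[of v w]
  proof (induction rule: rtranclp_induct)
    case (step y z)
    then show ?case using uniq[of y z v] sym by (auto simp: T_def)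
  qed (simp add: T_def)
  then have "UNIV = T" by auto
  moreover have "finite T" using deg by (simp add: T_def)
  ultimately show False using inf by simp
qed

text \<open>For each separated \<open>C\<close>, loops stay in the usable edges, which
  \<open>prob_uncancelled_le\<close> dominates; \<open>separated_domination\<close> then averages
  over \<open>C\<close>. What remains is to fit the constants to \<open>delta_loop\<close>.\<close>

lemma loop_conn_prob_le:
  fixes E :: "'v \<Rightarrow> 'v \<Rightarrow> bool"
  assumes sym: "\<And>x y. E x y \<Longrightarrow> E y x" and irrefl: "\<And>x. \<not> E x x"
    and K: "2 \<le> K" and deg: "\<And>x. finite {y. E x y} \<and> card {y. E x y} \<le> K"
    and S: "finite S" "S \<subseteq> gedges E"
    and \<beta>: "0 < \<beta>" and u: "0 \<le> u" "u \<le> 1"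
    and p: "(1 - exp (-\<beta>)) * (1 - delta_loop \<beta> u K) \<le> p" "0 \<le> p" "p \<le> 1"
  shows "measure_pmf.prob (loop_measure \<beta> u S) {c. \<exists>w\<in>A. loop_conn c v w}
    \<le> bern_exp (\<lambda>_. p) S (\<lambda>Z. of_bool (\<exists>w\<in>A. (\<lambda>x y. {x, y} \<in> Z)\<^sup>*\<^sup>* v w))"
proof -
  define q where "q = 1 - exp (-\<beta>)"
  define r where "r = \<beta> / (exp \<beta> - 1)"
  \<comment> \<open>The bound of \<open>prob_cancelled_ge\<close> in the worst case
    \<open>card A = 2 * K - 1\<close>.\<close>
  define x where "x = \<beta> * u\<^sup>2 * r ^ (2 * K - 1) / (2 * real K)"
  \<comment> \<open>\<open>\<kappa>\<close> is small enough for
    \<open>(1 + 2 * \<kappa>) ^ ((2 * K - 1)\<^sup>2)\<close> to be at most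
    \<open>exp 1 \<le> 3\<close>, and \<open>\<delta>\<close> is a third of
    \<open>\<kappa>\<close>.\<close>
  define \<delta> where "\<delta> = 1 / (24 * real K ^ 2)"
  define \<kappa> where "\<kappa> = 1 / (8 * real K ^ 2)"
  define F where "F = (\<lambda>Z. \<exists>w\<in>A. (\<lambda>x y. {x, y} \<in> Z)\<^sup>*\<^sup>* v w)"
  have K0: "real K \<ge> 2" using K by simp
  have q01: "0 \<le> q" "q \<le> 1" using \<beta> by (simp_all add: q_def)
  have exp1: "\<beta> \<le> exp \<beta> - 1" "0 < exp \<beta> - 1" using exp_ge_add_one_self[of \<beta>] \<beta> by linarith+
  have r01: "0 < r" "r \<le> 1" using exp1 \<beta> by (simp_all add: r_def)
  have \<beta>r: "\<beta> * r \<le> 2"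
  proof -
    have "\<beta>\<^sup>2 / 2 \<le> exp \<beta> - 1"
      using exp_lower_Taylor_quadratic[of \<beta>] \<beta> by simp
    then show ?thesis using exp1 by (simp add: r_def power2_eq_square field_simps)
  qed
  have u2: "0 \<le> u\<^sup>2" "u\<^sup>2 \<le> 1" using u by (simp_all add: power_le_one)
  have "0 \<le> x" using \<beta> u r01 by (simp add: x_def)
  \<comment> \<open>This amounts to \<open>q * x \<le> 1 - q\<close>. As \<open>2 * K - 1\<close> is
    at least 3, there are enough factors \<open>r\<close>: one absorbs
    \<open>exp \<beta> - 1\<close>, and two copies of \<open>\<beta> * r \<le> 2\<close> are
    balanced by \<open>2 * K \<ge> 4\<close>.\<close>
  have x_le: "x * (exp \<beta> - 1) \<le> 1"
  proof -
    have "2 * K - 1 = Suc (Suc (Suc (2 * K - 4)))" using K by simp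
    then have "x * (exp \<beta> - 1) = ((\<beta> * r) * (r * (exp \<beta> - 1) * r)) * (u\<^sup>2 * r ^ (2 * K - 4)) / (2 * real K)"
      unfolding x_def by (simp only: power_Suc) (simp add: mult_ac)
    also have "r * (exp \<beta> - 1) = \<beta>" using exp1 by (simp add: r_def)
    also have "(\<beta> * r) * (\<beta> * r) * (u\<^sup>2 * r ^ (2 * K - 4)) / (2 * real K) \<le> 2 * 2 * 1 / (2 * 2)"
      using K0 \<beta>r r01 u u2 \<beta> by (intro frac_le mult_mono mult_le_one power_le_one) auto
    also have "\<dots> = 1" by simp
    finally show ?thesis .
  qed
  have "x \<le> 1"
  proof -
    have "2 * K - 1 = Suc (2 * K - 2)" using K by simp
    then have "x = (\<beta> * r) * (u\<^sup>2 * r ^ (2 * K - 2)) / (2 * real K)"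
      unfolding x_def by (simp only: power_Suc) (simp add: mult_ac)
    also have "\<dots> \<le> 2 * 1 / (2 * 1)"
      using K0 \<beta>r r01 u u2 \<beta> by (intro frac_le mult_mono mult_le_one power_le_one) auto
    finally show ?thesis by simp
  qed
  have qx: "q * x \<le> 1 - q"
  proof -
    have "q * x = exp (-\<beta>) * (x * (exp \<beta> - 1))" by (simp add: q_def exp_minus field_simps)
    also have "\<dots> \<le> exp (-\<beta>) * 1" using x_le by (intro mult_left_mono) auto
    finally show ?thesis by (simp add: q_def)
  qed
  \<comment> \<open>\<open>delta_loop\<close> is \<open>x\<close> divided by
    \<open>K * (\<beta> + 3 * 4 ^ (K + 1))\<close>, and \<open>2 * K \<le> 4 ^ K\<close> makes this
    divisor at least \<open>24 * K\<^sup>2\<close>.\<close>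
  have delta: "delta_loop \<beta> u K \<le> x * \<delta>"
  proof -
    have "K < 2 ^ K" by (rule less_exp)
    then have "2 * K \<le> 2 ^ K * 2 ^ K" using K by (intro mult_mono) (auto simp: order_trans[OF K])
    then have "real (2 * K) \<le> real (2 ^ K * 2 ^ K)" by (rule of_nat_mono)
    then have pow4: "2 * real K \<le> 4 ^ K" by (simp flip: power_mult_distrib)
    have "delta_loop \<beta> u K = x * (1 / (real K * (\<beta> + 3 * 4 ^ (K + 1))))"
      using K0 by (simp add: delta_loop_def x_def r_def power2_eq_square field_simps)
    also have "\<dots> \<le> x * \<delta>"
    proof (rule mult_left_mono)
      have "24 * real K ^ 2 \<le> real K * (\<beta> + 3 * 4 ^ (K + 1))"
        using pow4 \<beta> K0 by (simp add: power2_eq_square)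
      then show "1 / (real K * (\<beta> + 3 * 4 ^ (K + 1))) \<le> \<delta>"
        unfolding \<delta>_def using K0 by (intro frac_le) auto
    qed fact
    finally show ?thesis .
  qed
  have \<kappa>_bound: "\<delta> * (1 + 2 * \<kappa>) ^ ((2 * K - 1)\<^sup>2) \<le> \<kappa>"
  proof -
    have "(1 + 2 * \<kappa>) ^ ((2 * K - 1)\<^sup>2) \<le> exp (2 * \<kappa>) ^ ((2 * K - 1)\<^sup>2)"
      using exp_ge_add_one_self[of "2 * \<kappa>"] K0 by (intro power_mono) (auto simp: \<kappa>_def)
    also have "\<dots> = exp (real ((2 * K - 1)\<^sup>2) * (2 * \<kappa>))" by (rule exp_of_nat_mult[symmetric])
    also have "\<dots> \<le> exp 1"
    proof -
      have "(2 * K - 1)\<^sup>2 \<le> (2 * K)\<^sup>2" by (intro power_mono) auto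
      then have "real ((2 * K - 1)\<^sup>2) \<le> real ((2 * K)\<^sup>2)" by (rule of_nat_mono)
      also have "\<dots> = 4 * real K ^ 2" by (simp add: power2_eq_square)
      finally show ?thesis using K0 by (simp add: \<kappa>_def field_simps)
    qed
    also have "exp (1 :: real) \<le> 3" by (rule exp_le)
    finally have "\<delta> * (1 + 2 * \<kappa>) ^ ((2 * K - 1)\<^sup>2) \<le> \<delta> * 3"
      by (intro mult_left_mono) (auto simp: \<delta>_def)
    also have "\<delta> * 3 = \<kappa>" by (simp add: \<delta>_def \<kappa>_def)
    finally show ?thesis .
  qed
  have F_mono: "F Z'" if "F Z" "Z \<subseteq> Z'" for Z Z'
  proof -
    have "(\<lambda>x y. {x, y} \<in> Z)\<^sup>*\<^sup>* \<le> (\<lambda>x y. {x, y} \<in> Z')\<^sup>*\<^sup>*"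
      by (rule rtranclp_mono) (use that(2) in auto)
    then show ?thesis using that(1) unfolding F_def by (auto dest: predicate2D)
  qed
  have ne: "{} \<notin> S" using S(2) by (auto simp: gedges_def)
  have loop: "measure_pmf.prob (loop_measure \<beta> u S) {c. \<exists>w\<in>A. loop_conn c v w}
      \<le> bern_exp (\<lambda>e. q * (if e \<in> C then 1 - x else 1)) S (\<lambda>Z. of_bool (F Z))"
    if C: "C \<in> separated (\<lambda>e f. touching S e \<inter> touching S f \<noteq> {}) S" for C
  proof -
    have CS: "C \<subseteq> S" "\<And>e f. e \<in> C \<Longrightarrow> f \<in> C \<Longrightarrow> e \<noteq> f \<Longrightarrow> touching S e \<inter> touching S f = {}"
      using C by (auto simp: separated_def)
    \<comment> \<open>On the support all links lie on genuine edges, as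
      \<open>loop_conn_imp_cluster\<close> requires.\<close>
    have "measure_pmf.prob (loop_measure \<beta> u S) {c. \<exists>w\<in>A. loop_conn c v w}
      = measure_pmf.prob (loop_measure \<beta> u S) ({c. \<exists>w\<in>A. loop_conn c v w} \<inter> set_pmf (loop_measure \<beta> u S))"
      by (rule measure_Int_set_pmf[symmetric])
    also have "\<dots> \<le> measure_pmf.prob (loop_measure \<beta> u S) {c. F (fst ` set c - {e \<in> C. cancelled c e})}"
    proof (rule measure_pmf.finite_measure_mono)
      show "{c. \<exists>w\<in>A. loop_conn c v w} \<inter> set_pmf (loop_measure \<beta> u S)
          \<subseteq> {c. F (fst ` set c - {e \<in> C. cancelled c e})}"
      proof safe
        fix c w assume c: "c \<in> set_pmf (loop_measure \<beta> u S)" and w: "w \<in> A" "loop_conn c v w"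
        have "(\<lambda>x y. {x, y} \<in> fst ` set c - {e \<in> C. cancelled c e})\<^sup>*\<^sup>* v w"
        proof (rule loop_conn_imp_cluster[OF _ _ _ w(2)])
          fix l assume "l \<in> set c"
          then have "l \<in> S \<times> {1, -1}" using set_loop_measure[OF S(1) c] by blast
          then have "fst l \<in> gedges E" using S(2) by (auto simp only: mem_Times_iff)
          then obtain a b where "fst l = {a, b}" "E a b" by (auto simp: gedges_def)
          then show "\<exists>x y. x \<noteq> y \<and> fst l = {x, y}" using irrefl[of a] by metis
        next
          fix e f assume ef: "e \<in> {e \<in> C. cancelled c e}" "f \<in> {e \<in> C. cancelled c e}" "e \<noteq> f"
          then have "touching S e \<inter> touching S f = {}" using CS(2) by auto
          moreover have "e \<in> S" "f \<in> S" using ef CS(1) by auto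
          ultimately show "e \<inter> f = {}" using ne by (auto simp: touching_def)
        next
          show "cancelled c e \<and> e \<noteq> {}" if "e \<in> {e \<in> C. cancelled c e}" for e
            using that CS(1) ne by auto
        qed
        then show "F (fst ` set c - {e \<in> C. cancelled c e})" using w(1) by (auto simp: F_def)
      qed
    qed simp
    also have "\<dots> \<le> bern_exp (\<lambda>e. q * (if e \<in> C then 1 - x else 1)) S (\<lambda>Z. of_bool (F Z))"
      unfolding q_def
    proof (rule prob_uncancelled_le[OF S(1) ne \<beta> u CS])
      fix e B assume e: "e \<in> C" and B: "B \<subseteq> touching S e"
      have "e \<in> gedges E" using e CS(1) S(2) by auto
      note t = card_touching_le[of E K S e, OF sym deg S(2) this]
      have card: "card B \<le> 2 * K - 1" using card_mono[OF t(1) B] t(2) by simp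
      then have "real (card B) + 1 \<le> 2 * real K" using K by linarith
      moreover have "r ^ (2 * K - 1) \<le> r ^ card B" using card r01 by (intro power_decreasing) auto
      ultimately have "x \<le> \<beta> * u\<^sup>2 * r ^ card B / (real (card B) + 1)"
        unfolding x_def using \<beta> u2 r01 by (intro frac_le mult_left_mono) auto
      then show "x \<le> \<beta> * u\<^sup>2 * (\<beta> / (exp \<beta> - 1)) ^ card B / (real (card B) + 1)"
        by (simp add: r_def)
    qed (use \<open>0 \<le> x\<close> \<open>x \<le> 1\<close> F_mono in auto)
    finally show ?thesis .
  qed
  have "measure_pmf.prob (loop_measure \<beta> u S) {c. \<exists>w\<in>A. loop_conn c v w}
      \<le> bern_exp (\<lambda>_. p) S (\<lambda>Z. of_bool (F Z))"
  proof (rule separated_domination[where R = "\<lambda>e f. touching S e \<inter> touching S f \<noteq> {}", OF S(1) _ _ _ q01 \<open>0 \<le> x\<close> \<open>x \<le> 1\<close> qx _ \<kappa>_bound _ _ p(2,3) _ loop])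
    show "card {f \<in> S. touching S e \<inter> touching S f \<noteq> {}} \<le> (2 * K - 1)\<^sup>2" if "e \<in> S" for e
      using that S(2) by (intro card_touching_twice_le[of E, OF sym deg]) auto
    show "q * (1 - x * \<delta>) \<le> p"
      using p(1) mult_left_mono[OF delta q01(1)] by (simp add: q_def[symmetric] algebra_simps)
    show "mono (\<lambda>Z. of_bool (F Z) :: real)"
      using F_mono by (intro monoI) auto
  qed (use K0 ne in \<open>auto simp: touching_def \<kappa>_def \<delta>_def\<close>)
  then show ?thesis by (simp add: F_def)
qed

theorem theorem1p2:
  fixes E :: "'v \<Rightarrow> 'v \<Rightarrow> bool" and K :: nat and V :: "nat \<Rightarrow> 'v set"
    and v0 :: 'v and \<beta> u :: real
  assumes sym: "\<And>x y. E x y \<Longrightarrow> E y x"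
    and irrefl: "\<And>x. \<not> E x x"
    and inf: "infinite (UNIV :: 'v set)"
    and conn: "\<And>x y. E\<^sup>*\<^sup>* x y"
    and deg: "\<And>x. finite {y. E x y} \<and> card {y. E x y} \<le> K"
    and incr: "\<And>m. m \<ge> 1 \<Longrightarrow> V m \<subseteq> V (Suc m)"
    and fin: "\<And>m. m \<ge> 1 \<Longrightarrow> finite (V m)"
    and cover: "(\<Union>m\<in>{1..}. V m) = UNIV"
    and sub_conn: "\<And>m x y. m \<ge> 1 \<Longrightarrow> x \<in> V m \<Longrightarrow> y \<in> V m \<Longrightarrow> (induced E (V m))\<^sup>*\<^sup>* x y"
    and v0: "v0 \<in> V 1"
    and beta: "\<beta> > 0"
    and u: "0 \<le> u" "u \<le> 1"
    and hyp: "(1 - exp (-\<beta>)) * (1 - delta_loop \<beta> u K) < p_crit E v0"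
  shows "liminf (\<lambda>R::nat. liminf (\<lambda>m. ereal (measure_pmf.prob
            (loop_measure \<beta> u (gedges (induced E (V m))))
            {c. \<exists>w\<in>V m. gdist E v0 w \<ge> R \<and> loop_conn c v0 w}))) = 0"
proof -
  have K: "2 \<le> K" using sym inf conn deg by (rule infinite_connected_max_degree_ge_2)
  obtain p where p: "0 \<le> p" "p \<le> 1" "(1 - exp (-\<beta>)) * (1 - delta_loop \<beta> u K) < p" "perc_theta E v0 p = 0"
    using p_crit_less[of E v0, OF _ hyp] deg by blast
  \<comment> \<open>Countability, needed for measurability of \<open>far_cluster\<close>, comes from
    the exhaustion by finite sets.\<close>
  have cnt: "countable (UNIV :: 'v set)"
    unfolding cover[symmetric] using fin by (intro countable_UN) (auto intro: countable_finite)
  define P where "P = (\<lambda>R m. measure_pmf.prob (loop_measure \<beta> u (gedges (induced E (V m))))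
      {c. \<exists>w\<in>V m. gdist E v0 w \<ge> R \<and> loop_conn c v0 w})"
  define D where "D = (\<lambda>R. measure (perc_measure E p) (far_cluster E p v0 R))"
  \<comment> \<open>The bound is uniform in \<open>m\<close>: open paths in the finite graph are
    open paths in \<open>E\<close>, and both events measure distance in \<open>E\<close>.\<close>
  have P_le: "P R m \<le> D R" if m: "m \<ge> 1" for R m
  proof -
    let ?S = "gedges (induced E (V m))" and ?A = "{w \<in> V m. R \<le> gdist E v0 w}"
    have S: "finite ?S" "?S \<subseteq> gedges E"
    proof -
      have "?S \<subseteq> Pow (V m)" by (auto simp: gedges_def induced_def)
      then show "finite ?S" using fin[OF m] finite_subset by blast
    qed (auto simp: gedges_def induced_def)
    have "P R m = measure_pmf.prob (loop_measure \<beta> u ?S) {c. \<exists>w\<in>?A. loop_conn c v0 w}"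
      unfolding P_def by (intro arg_cong2[of _ _ _ _ measure]) auto
    also have "\<dots> \<le> bern_exp (\<lambda>_. p) ?S (\<lambda>Z. of_bool (\<exists>w\<in>?A. (\<lambda>x y. {x, y} \<in> Z)\<^sup>*\<^sup>* v0 w))"
      using p(3) by (intro loop_conn_prob_le[OF sym irrefl K deg S beta u _ p(1,2)]) auto
    also have "\<dots> \<le> D R"
      unfolding D_def
    proof (rule bern_exp_le_perc[OF S p(1,2) sets_far_cluster[OF cnt]])
      fix \<omega> assume \<omega>: "\<omega> \<in> space (perc_measure E p)"
        and "\<exists>w\<in>?A. (\<lambda>x y. {x, y} \<in> {e \<in> ?S. \<omega> e})\<^sup>*\<^sup>* v0 w"
      then obtain w where w: "R \<le> gdist E v0 w" "(\<lambda>x y. {x, y} \<in> {e \<in> ?S. \<omega> e})\<^sup>*\<^sup>* v0 w" by auto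
      have "(\<lambda>x y. {x, y} \<in> {e \<in> ?S. \<omega> e})\<^sup>*\<^sup>* \<le> (\<lambda>x y. E x y \<and> \<omega> {x, y})\<^sup>*\<^sup>*"
        by (rule rtranclp_mono) (use sym in \<open>auto simp: gedges_def induced_def doubleton_eq_iff\<close>)
      then have "(\<lambda>x y. E x y \<and> \<omega> {x, y})\<^sup>*\<^sup>* v0 w"
        using w(2) by (rule predicate2D)
      then show "\<omega> \<in> far_cluster E p v0 R" using \<omega> w(1) by (auto simp: far_cluster_def open_cluster_def)
    qed
    finally show ?thesis .
  qed
  have "D \<longlonglongrightarrow> 0"
    using far_cluster_tendsto[OF cnt conn, of p v0] deg p(4) unfolding D_def by simp
  then have lim: "(\<lambda>R. ereal (D R)) \<longlonglongrightarrow> 0" by (simp add: zero_ereal_def)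
  \<comment> \<open>The inner limes inferior lies between \<open>0\<close> and \<open>D R\<close>,
    so it tends to \<open>0\<close> as \<open>R\<close> grows.\<close>
  have lower: "0 \<le> liminf (\<lambda>m. ereal (P R m))" for R
    by (intro Liminf_bounded) (auto simp: P_def)
  have upper: "liminf (\<lambda>m. ereal (P R m)) \<le> ereal (D R)" for R
  proof -
    have "liminf (\<lambda>m. ereal (P R m)) \<le> liminf (\<lambda>m. ereal (D R))"
      by (intro Liminf_mono eventually_sequentiallyI[of 1]) (simp add: P_le)
    then show ?thesis by (simp add: Liminf_const)
  qed
  have "(\<lambda>R. liminf (\<lambda>m. ereal (P R m))) \<longlonglongrightarrow> 0"
    by (rule tendsto_sandwich[OF _ _ tendsto_const lim]) (auto simp: lower upper)
  then have "liminf (\<lambda>R. liminf (\<lambda>m. ereal (P R m))) = 0"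
    by (intro lim_imp_Liminf) auto
  then show ?thesis by (simp add: P_def)
qed

end
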